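(* Let $c_\epsilon$ be the Su-Schrieffer-Heeger interface medium with $d=\tfrac12$ (so with separation parameter $\tfrac12-\epsilon$ to the left and $\tfrac12+\epsilon$ to the right of the interface). Let $u$ be a localised eigenmode of $u''+\frac{\omega^2}{c_\epsilon^2(x)}u=0$ which obeys the homogenisation ansatz with small parameter $\epsilon$ (as defined in the context). Then, when normalised such that $\max_n|u(x_n)|=1$, it satisfies $$|u(x_n)|=\exp\Big(-\tfrac12\sqrt{\big((T_B)_{12}-(T_A)_{12}\big)\big((T_B)_{21}-(T_A)_{21}\big)}\;|n|\Big)+O(\epsilon)\qquad\text{for } n\in\mathbb{Z},$$ where $T_A,T_B$ are evaluated at the eigenfrequency $\omega$ of $u$.
   Context: Medium: fix $r>0$, $r\ne1$, $0<a<\frac12$ and $d=\frac12$, and let $\epsilon>0$ be small enough that $a<d-\epsilon$ and $d+\epsilon<1-a$. For $s\in(a,1-a)$ and $n\in\mathbb{Z}$ let $$I_n(s)=\big[n+\tfrac{1-s-a}{2},\,n+\tfrac{1-s+a}{2}\big)\cup\big[n+\tfrac{1+s-a}{2},\,n+\tfrac{1+s+a}{2}\big).$$ Then $c_\epsilon(x)=\frac1r$ if $x\in I_n(d-\epsilon)$ for some integer $n<0$ or $x\in I_n(d+\epsilon)$ for some integer $n\ge0$, and $c_\epsilon(x)=1$ otherwise. The mesh is $x_n=n$ (unit cell of length $1$), with interface at $x_0=0$. A localised eigenmode with eigenfrequency $\omega\in\mathbb{R}$ is a nonzero $C^1$ solution $u\in L^2(\mathbb{R})$ of the equation (holding away from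 discontinuities of $c_\epsilon$) that decays at $\pm\infty$; its frequency lies in the common spectral band gap of the two periodic media on either side of the interface. Matrices: $T_A(\omega)$, $T_B(\omega)\in\mathbb{R}^{2\times2}$ are the matrices such that every solution satisfies $(u(x_{n+1}),u'(x_{n+1}))^\top=T_A(u(x_n),u'(x_n))^\top$ for $n<0$ and $=T_B(u(x_n),u'(x_n))^\top$ for $n\ge0$. Define $P=P(\omega)$ by $\epsilon P=T_B-T_A$. With $v(x_n)=u'(x_n)$, every solution satisfies, for all $n\in\mathbb{Z}$, $$\begin{pmatrix}u(x_{n+1})+u(x_{n-1})\\ v(x_{n+1})-v(x_{n-1})\end{pmatrix}=2T_A\begin{pmatrix}u(x_n)\\ 0\end{pmatrix}+\mathbf{1}_{n>0}2\epsilon P\begin{pmatrix}u(x_n)\\ 0\end{pmatrix}+\delta_{n,0}\,\epsilon P\begin{pmatrix}u(x_n)\\ v(x_n)\end{pmatrix},$$ $$\begin{pmatrix}u(x_{n+1})-u(x_{n-1})\\ v(x_{n+1})+v(x_{n-1})\end{pmatrix}=2T_A\begin{pmatrix}0\\ v(x_n)\end{pmatrix}+\mathbf{1}_{n>0}2\epsilon P\begin{pmatrix}0\\ v(x_n)\end{pmatrix}+\delta_{n,0}\,\epsilon P\begin{pmatrix}u(x_n)\\ v(x_n)\end{pmatrix}.$$ Homogenisation ansatz: put $\eta=\epsilon n$. (i) Up to anti-periodic alternation between adjacent mesh points, $u$ and $v$ are functions of the long-scale variable: relative to the reference point $n$, $u(x_n)=u(\eta)$ and $u(x_{n\pm1})=-u(\eta\pm\epsilon)$,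 and likewise for $v$. (ii) $u=u_0+\epsilon u_1+\epsilon^2u_2+\dots$ and $v=v_0+\epsilon v_1+\epsilon^2v_2+\dots$, where the terms are continuous functions of $\eta$ decaying as $\eta\to\pm\infty$, and $u_0\not\equiv0$. (iii) $\omega$ is expanded in powers of $\epsilon$ with leading-order term a value at the edge of the band gap (where the Bloch waves are anti-periodic). This gives $T_A(\omega)=T_0+\epsilon T_1+\epsilon^2T_2+\dots$ and $P(\omega)=P_0+O(\epsilon)$. It is assumed that $-2(T_2)_{11}>0$. (iv) The Kronecker delta is moved to the long scale by $\delta_{n,0}=\epsilon\delta(\eta)$, with $\delta$ the Dirac distribution, and $\mathbf{1}_{n>0}$ by $\mathbf{1}_{\eta>0}$, and $u(\eta\pm\epsilon)$, $v(\eta\pm\epsilon)$ are Taylor expanded. In particular, the first component of the first system and the second component of the second system become $$-2u-\epsilon^2u_{\eta\eta}=2(T_A)_{11}u+\mathbf{1}_{\eta>0}2\epsilon P_{11}u+\epsilon^2\delta(\eta)(P_{11}u+P_{12}v)+O(\epsilon^3),$$ $$-2v-\epsilon^2v_{\eta\eta}=2(T_A)_{22}v+\mathbf{1}_{\eta>0}2\epsilon P_{22}v+\epsilon^2\delta(\eta)(P_{21}u+P_{22}v)+O(\epsilon^3).$$ After inserting the expansions in (ii) and (iii), these equations hold, in the sense of distributions in $\eta$, separately at orders $\epsilon^0,\epsilon^1,\epsilon^2$, with $\delta(\eta)$ treated as an order-one quantity. First-order corrections $u_1$ and $v_1$, when they are multiples of $u_0$ and $v_0$, are absorbed into $u_0$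 and $v_0$. *)

theory Defs
  imports "HOL-Analysis.Analysis" "HOL-Library.Landau_Symbols"
begin

section \<open>The Su-Schrieffer-Heeger interface medium\<close>

definition inclusion :: "real \<Rightarrow> real \<Rightarrow> int \<Rightarrow> real set" where
  "inclusion a s n =
     {of_int n + (1 - s - a) / 2 ..< of_int n + (1 - s + a) / 2} \<union>
     {of_int n + (1 + s - a) / 2 ..< of_int n + (1 + s + a) / 2}"

definition periodic_medium :: "real \<Rightarrow> real \<Rightarrow> real \<Rightarrow> real \<Rightarrow> real" where
  "periodic_medium r a s x = (if \<exists>n. x \<in> inclusion a s n then 1 / r else 1)"

definition interface_medium :: "real \<Rightarrow> real \<Rightarrow> real \<Rightarrow> real \<Rightarrow> real \<Rightarrow> real" where
  "interface_medium r a d \<epsilon> x =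
     (if (\<exists>n<0. x \<in> inclusion a (d - \<epsilon>) n) \<or> (\<exists>n\<ge>0. x \<in> inclusion a (d + \<epsilon>) n)
      then 1 / r else 1)"

abbreviation deriv1 :: "(real \<Rightarrow> 'a::real_normed_vector) \<Rightarrow> real \<Rightarrow> 'a" where
  "deriv1 u x \<equiv> vector_derivative u (at x)"

text \<open>
  The codomain is real for eigenmodes and transfer matrices, complex for Bloch waves.
\<close>
definition wave_solution ::
    "(real \<Rightarrow> real) \<Rightarrow> real \<Rightarrow> (real \<Rightarrow> 'a::real_normed_vector) \<Rightarrow> bool" where
  "wave_solution c \<omega> u \<longleftrightarrow>
     u C1_differentiable_on UNIV \<and>
     (\<forall>x. isCont c x \<longrightarrow>
        (deriv1 u has_vector_derivative - (\<omega>\<^sup>2 / (c x)\<^sup>2) *\<^sub>R u x) (at x))"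

definition bloch_wave :: "(real \<Rightarrow> real) \<Rightarrow> real \<Rightarrow> real \<Rightarrow> (real \<Rightarrow> complex) \<Rightarrow> bool" where
  "bloch_wave c \<omega> k w \<longleftrightarrow>
     wave_solution c \<omega> w \<and> (\<exists>x. w x \<noteq> 0) \<and> (\<forall>x. w (x + 1) = cis k * w x)"

text \<open>
  By Floquet-Bloch theory, a frequency is in the spectrum of a medium of period one iff it
  admits a Bloch wave with real quasi-momentum; the gaps are the remaining frequencies.
\<close>
definition gap_frequencies :: "(real \<Rightarrow> real) \<Rightarrow> real set" where
  "gap_frequencies c = {\<omega>. \<not> (\<exists>k w. bloch_wave c \<omega> k w)}"

definition common_gap_frequencies :: "real \<Rightarrow> real \<Rightarrow> real \<Rightarrow> real \<Rightarrow> real set" where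
  "common_gap_frequencies r a d \<epsilon> =
     gap_frequencies (periodic_medium r a (d - \<epsilon>)) \<inter>
     gap_frequencies (periodic_medium r a (d + \<epsilon>))"

definition localised_eigenmode ::
    "real \<Rightarrow> real \<Rightarrow> real \<Rightarrow> real \<Rightarrow> real \<Rightarrow> (real \<Rightarrow> real) \<Rightarrow> bool" where
  "localised_eigenmode r a d \<epsilon> \<omega> u \<longleftrightarrow>
     wave_solution (interface_medium r a d \<epsilon>) \<omega> u \<and>
     (\<exists>x. u x \<noteq> 0) \<and>
     integrable lborel (\<lambda>x. (u x)\<^sup>2) \<and>
     (u \<longlongrightarrow> 0) at_top \<and> (u \<longlongrightarrow> 0) at_bot \<and>
     \<omega> \<in> common_gap_frequencies r a d \<epsilon>"


section \<open>Transfer matrices on the mesh of the integers\<close>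

definition cell_state :: "(real \<Rightarrow> real) \<Rightarrow> int \<Rightarrow> real^2" where
  "cell_state u n = vector [u (of_int n), deriv1 u (of_int n)]"

definition left_transfer_matrix :: "(real \<Rightarrow> real) \<Rightarrow> real \<Rightarrow> real^2^2 \<Rightarrow> bool" where
  "left_transfer_matrix c \<omega> T \<longleftrightarrow>
     (\<forall>u. wave_solution c \<omega> u \<longrightarrow> (\<forall>n<0. cell_state u (n + 1) = T *v cell_state u n))"

definition right_transfer_matrix :: "(real \<Rightarrow> real) \<Rightarrow> real \<Rightarrow> real^2^2 \<Rightarrow> bool" where
  "right_transfer_matrix c \<omega> T \<longleftrightarrow>
     (\<forall>u. wave_solution c \<omega> u \<longrightarrow> (\<forall>n\<ge>0. cell_state u (n + 1) = T *v cell_state u n))"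


section \<open>Distributions on the real line\<close>

text \<open>
  Only regular distributions of locally integrable functions, their derivatives and the Dirac
  distribution occur below, so distributions are represented by their action on test functions.
\<close>

definition test_function :: "(real \<Rightarrow> real) \<Rightarrow> bool" where
  "test_function \<phi> \<longleftrightarrow>
     (\<forall>k x. (deriv ^^ k) \<phi> differentiable (at x)) \<and> (\<exists>R. \<forall>x. \<bar>x\<bar> > R \<longrightarrow> \<phi> x = 0)"

type_synonym distribution = "(real \<Rightarrow> real) \<Rightarrow> real"

definition eq_distribution :: "distribution \<Rightarrow> distribution \<Rightarrow> bool" (infix "\<simeq>\<^sub>D" 50) where
  "D \<simeq>\<^sub>D E \<longleftrightarrow> (\<forall>\<phi>. test_function \<phi> \<longrightarrow> D \<phi> = E \<phi>)"

definition regular :: "(real \<Rightarrow> real) \<Rightarrow> distribution" where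
  "regular f = (\<lambda>\<phi>. LINT x|lborel. f x * \<phi> x)"

definition dirac :: distribution where
  "dirac = (\<lambda>\<phi>. \<phi> 0)"

definition distribution_deriv :: "distribution \<Rightarrow> distribution" where
  "distribution_deriv D = (\<lambda>\<phi>. - D (deriv \<phi>))"

text \<open>Below, the Dirac distribution is only multiplied by continuous functions.\<close>
definition distribution_mult :: "(real \<Rightarrow> real) \<Rightarrow> distribution \<Rightarrow> distribution" where
  "distribution_mult f D = (\<lambda>\<phi>. D (\<lambda>x. f x * \<phi> x))"

definition distribution_add :: "distribution \<Rightarrow> distribution \<Rightarrow> distribution"
    (infixl "\<oplus>\<^sub>D" 65) where
  "D \<oplus>\<^sub>D E = (\<lambda>\<phi>. D \<phi> + E \<phi>)"

definition distribution_minus :: "distribution \<Rightarrow> distribution \<Rightarrow> distribution"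
    (infixl "\<ominus>\<^sub>D" 65) where
  "D \<ominus>\<^sub>D E = (\<lambda>\<phi>. D \<phi> - E \<phi>)"


section \<open>Expansions in powers of the small parameter\<close>

definition power_expansion :: "(real \<Rightarrow> 'a::real_normed_vector) \<Rightarrow> (nat \<Rightarrow> 'a) \<Rightarrow> bool" where
  "power_expansion f c \<longleftrightarrow>
     (\<forall>N. (\<lambda>\<epsilon>. norm (f \<epsilon> - (\<Sum>k<N. \<epsilon> ^ k *\<^sub>R c k))) \<in> O[at_right 0](\<lambda>\<epsilon>. \<epsilon> ^ N))"

text \<open>For functions of the long-scale variable, the remainders are uniform in that variable.\<close>
definition uniform_power_expansion ::
    "(real \<Rightarrow> real \<Rightarrow> real) \<Rightarrow> (nat \<Rightarrow> real \<Rightarrow> real) \<Rightarrow> bool" where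
  "uniform_power_expansion f c \<longleftrightarrow>
     (\<forall>N. \<exists>C. \<forall>\<^sub>F \<epsilon> in at_right 0.
        \<forall>\<eta>. \<bar>f \<epsilon> \<eta> - (\<Sum>k<N. \<epsilon> ^ k * c k \<eta>)\<bar> \<le> C * \<epsilon> ^ N)"


section \<open>The homogenisation ansatz\<close>

definition continuous_decaying :: "(real \<Rightarrow> real) \<Rightarrow> bool" where
  "continuous_decaying f \<longleftrightarrow>
     continuous_on UNIV f \<and> (f \<longlongrightarrow> 0) at_top \<and> (f \<longlongrightarrow> 0) at_bot"

text \<open>
  With \<open>w\<close> standing for \<open>u\<close> if \<open>i = 1\<close> and for \<open>v\<close> if \<open>i = 2\<close>, these are the coefficients of
  \<open>\<epsilon>\<^sup>0\<close>, \<open>\<epsilon>\<^sup>1\<close> and \<open>\<epsilon>\<^sup>2\<close> in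
  \<open>-2 w - \<epsilon>\<^sup>2 w'' = 2 T\<^sub>i\<^sub>i w + 1\<^bsub>\<eta>>0\<^esub> 2 \<epsilon> P\<^sub>i\<^sub>i w + \<epsilon>\<^sup>2 \<delta> (P\<^sub>i\<^sub>1 u + P\<^sub>i\<^sub>2 v)\<close>
  after inserting the expansions of \<open>u\<close>, \<open>v\<close>, \<open>T\<close> and \<open>P\<close>; the second argument of \<open>w\<close> etc. is
  the long-scale variable.
\<close>
definition order_equations ::
    "2 \<Rightarrow> (nat \<Rightarrow> real \<Rightarrow> real) \<Rightarrow> (nat \<Rightarrow> real \<Rightarrow> real) \<Rightarrow> (nat \<Rightarrow> real \<Rightarrow> real) \<Rightarrow>
     (nat \<Rightarrow> real^2^2) \<Rightarrow> (nat \<Rightarrow> real^2^2) \<Rightarrow> bool" where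
  "order_equations i w u v T P \<longleftrightarrow>
     regular (\<lambda>\<eta>. - 2 * w 0 \<eta>) \<simeq>\<^sub>D regular (\<lambda>\<eta>. 2 * (T 0 $ i $ i) * w 0 \<eta>) \<and>
     regular (\<lambda>\<eta>. - 2 * w 1 \<eta>) \<simeq>\<^sub>D
       regular (\<lambda>\<eta>. 2 * ((T 0 $ i $ i) * w 1 \<eta> + (T 1 $ i $ i) * w 0 \<eta>)
                  + indicator {0<..} \<eta> * (2 * (P 0 $ i $ i) * w 0 \<eta>)) \<and>
     regular (\<lambda>\<eta>. - 2 * w 2 \<eta>) \<ominus>\<^sub>D distribution_deriv (distribution_deriv (regular (w 0))) \<simeq>\<^sub>D
       regular (\<lambda>\<eta>. 2 * ((T 0 $ i $ i) * w 2 \<eta> + (T 1 $ i $ i) * w 1 \<eta> + (T 2 $ i $ i) * w 0 \<eta>)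
                  + indicator {0<..} \<eta> *
                      (2 * ((P 0 $ i $ i) * w 1 \<eta> + (P 1 $ i $ i) * w 0 \<eta>)))
       \<oplus>\<^sub>D distribution_mult (\<lambda>\<eta>. (P 0 $ i $ 1) * u 0 \<eta> + (P 0 $ i $ 2) * v 0 \<eta>) dirac"

text \<open>
  The ansatz concerns a family \<open>u \<epsilon>\<close> with frequencies \<open>\<omega> \<epsilon>\<close> as \<open>\<epsilon>\<close> tends to zero from
  above. The anti-periodic alternation between adjacent mesh points is the factor \<open>(-1)\<^sup>n\<close>
  relating \<open>u \<epsilon>\<close> and its derivative at the mesh points to the long-scale functions \<open>U \<epsilon>\<close> and
  \<open>V \<epsilon>\<close>. The two periodic media with \<open>d = 1/2\<close> have no gap there when \<open>\<epsilon> = 0\<close>, so that the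
  leading-order term of the frequency is a band edge in the sense of being the limit of edges
  \<open>e \<epsilon>\<close> of the gap that contains \<open>\<omega> \<epsilon>\<close>.

  The corrections \<open>us 1\<close> and \<open>vs 1\<close> are kept even if they are multiples of \<open>us 0\<close> and \<open>vs 0\<close>;
  absorbing them would be a special case.
\<close>
definition homogenisation_ansatz ::
    "real \<Rightarrow> real \<Rightarrow> real \<Rightarrow> (real \<Rightarrow> real \<Rightarrow> real^2^2) \<Rightarrow> (real \<Rightarrow> real \<Rightarrow> real^2^2) \<Rightarrow>
     (real \<Rightarrow> real) \<Rightarrow> (real \<Rightarrow> real \<Rightarrow> real) \<Rightarrow> bool" where
  "homogenisation_ansatz r a d TA TB \<omega> u \<longleftrightarrow>
     (\<exists>U V us vs \<omega>s T P e.
        \<comment> \<open>long-scale functions\<close>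
        (\<forall>\<^sub>F \<epsilon> in at_right 0. \<forall>n::int.
           u \<epsilon> (of_int n) = (-1) powi n * U \<epsilon> (\<epsilon> * of_int n) \<and>
           deriv1 (u \<epsilon>) (of_int n) = (-1) powi n * V \<epsilon> (\<epsilon> * of_int n)) \<and>
        uniform_power_expansion U us \<and> uniform_power_expansion V vs \<and>
        (\<forall>k. continuous_decaying (us k) \<and> continuous_decaying (vs k)) \<and>
        (\<exists>\<eta>. us 0 \<eta> \<noteq> 0) \<and>
        \<comment> \<open>frequency and transfer matrices\<close>
        power_expansion \<omega> \<omega>s \<and>
        (\<forall>\<^sub>F \<epsilon> in at_right 0.
           e \<epsilon> \<in> frontier (connected_component_set (common_gap_frequencies r a d \<epsilon>) (\<omega> \<epsilon>)) \<and>
           (\<exists>w. bloch_wave (periodic_medium r a (d - \<epsilon>)) (e \<epsilon>) pi w) \<and>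
           (\<exists>w. bloch_wave (periodic_medium r a (d + \<epsilon>)) (e \<epsilon>) pi w)) \<and>
        (e \<longlongrightarrow> \<omega>s 0) (at_right 0) \<and>
        power_expansion (\<lambda>\<epsilon>. TA \<epsilon> (\<omega> \<epsilon>)) T \<and>
        power_expansion (\<lambda>\<epsilon>. (1 / \<epsilon>) *\<^sub>R (TB \<epsilon> (\<omega> \<epsilon>) - TA \<epsilon> (\<omega> \<epsilon>))) P \<and>
        - 2 * (T 2 $ 1 $ 1) > 0 \<and>
        \<comment> \<open>homogenised equations, order by order\<close>
        order_equations 1 us us vs T P \<and>
        order_equations 2 vs us vs T P)"

end

theory Submission
  imports Defs "HOL-Computational_Algebra.Polynomial"
begin

text \<open>
  Write \<open>U0\<close>, \<open>V0\<close> for the leading terms of \<open>u\<close> and \<open>v\<close> on the long scale, \<open>T\<^sub>k\<close>, \<open>P\<^sub>k\<close> for the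
  coefficients of the transfer matrix and of \<open>P\<close>, and put \<open>l\<^sup>2 = - 2 (T\<^sub>2)\<^sub>1\<^sub>1\<close>.

  The medium has two exact symmetries. Every unit cell is mirror symmetric about its midpoint, and for
  \<open>d = 1/2\<close> the periodic medium on the right is the one on the left, shifted by half a period.
  Together they force all four diagonal entries of \<open>T\<^sub>A\<close> and \<open>T\<^sub>B\<close> to be the same number at every
  frequency (\<open>transfer_matrices_equal_diagonals\<close>). Hence \<open>P\<close> has a vanishing diagonal, all terms with
  a jump at \<open>\<eta> = 0\<close> disappear from the homogenised equations, and \<open>u\<close> and \<open>v\<close> obey the same
  equation apart from the point source.

  The orders zero and one then only say that \<open>(T\<^sub>0)\<^sub>1\<^sub>1 = -1\<close> and \<open>(T\<^sub>1)\<^sub>1\<^sub>1 = 0\<close>, because \<open>U0\<close> does not vanish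
  identically. At order two \<open>U0'' = l\<^sup>2 U0 - (P\<^sub>0)\<^sub>1\<^sub>2 V0(0) \<delta>\<close> and \<open>V0'' = l\<^sup>2 V0 - (P\<^sub>0)\<^sub>2\<^sub>1 U0(0) \<delta>\<close>.
  A decaying solution of such an equation is a multiple of \<open>exp (- l \<bar>\<eta>\<bar>)\<close>, and comparing
  the kink at the origin with the point source gives \<open>2 l U0(0) = (P\<^sub>0)\<^sub>1\<^sub>2 V0(0)\<close> and
  \<open>2 l V0(0) = (P\<^sub>0)\<^sub>2\<^sub>1 U0(0)\<close> (\<open>order_equations_profile\<close>). Since \<open>U0(0) \<noteq> 0\<close>, eliminating \<open>V0(0)\<close>
  leaves \<open>4 l\<^sup>2 = (P\<^sub>0)\<^sub>1\<^sub>2 (P\<^sub>0)\<^sub>2\<^sub>1\<close>, so that up to an error of second order \<open>\<epsilon> l\<close> is half the root of the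
  product of the off-diagonal entries of \<open>T\<^sub>B - T\<^sub>A\<close>. Neither this change of the decay rate
  (\<open>exp_rate_perturbation\<close>) nor the normalisation on the mesh instead of at the origin
  (\<open>normalised_profile\<close>) costs more than \<open>O(\<epsilon>)\<close>, uniformly in \<open>n\<close>.

  The argument rests on two analytic facts. A matrix is a transfer matrix if it propagates all
  solutions, so the symmetries constrain it only once enough solutions of the wave
  equation with discontinuous coefficient are known to exist (\<open>wave_solution_exists\<close>). And the homogenised
  equations hold as distributions, so that passing to pointwise identities needs enough test
  functions (\<open>regular_eq_imp_eq\<close>) and a uniqueness result for weak solutions
  (\<open>bounded_weak_solution_zero\<close>).
\<close>

section \<open>Test functions\<close>

definition smooth :: "(real \<Rightarrow> real) \<Rightarrow> bool" where
  "smooth f \<longleftrightarrow> (\<forall>k x. (deriv ^^ k) f differentiable (at x))"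

text \<open>
  Smoothness of concrete functions is shown by exhibiting a family of functions that contains them and
  is closed under differentiation.
\<close>
lemma smooth_coinduct:
  assumes "f \<in> F" and "\<And>f. f \<in> F \<Longrightarrow> \<exists>f'\<in>F. \<forall>x. (f has_real_derivative f' x) (at x)"
  shows "smooth f"
proof -
  have F: "deriv g \<in> F" and F_diff: "\<forall>x. g differentiable (at x)" if g: "g \<in> F" for g
  proof -
    obtain g' where g': "g' \<in> F" "\<And>x. (g has_real_derivative g' x) (at x)"
      using assms(2)[OF g] by blast
    then have "deriv g = g'"
      by (auto intro: DERIV_imp_deriv)
    then show "deriv g \<in> F" "\<forall>x. g differentiable (at x)"
      using g' by (auto simp: real_differentiable_def)
  qed
  have "(deriv ^^ k) f \<in> F" for k
    by (induction k) (use \<open>f \<in> F\<close> F in auto)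
  then show ?thesis
    unfolding smooth_def using F_diff by blast
qed

lemma smooth_has_derivative:
  assumes "smooth f"
  shows "(f has_real_derivative deriv f x) (at x)"
  using assms[unfolded smooth_def, rule_format, of 0 x]
  by (simp add: DERIV_deriv_iff_real_differentiable)

lemma smooth_deriv:
  assumes "smooth f"
  shows "smooth (deriv f)"
  unfolding smooth_def
proof (intro allI)
  fix k x
  show "(deriv ^^ k) (deriv f) differentiable at x"
    using assms[unfolded smooth_def, rule_format, of "Suc k" x] by (simp add: funpow_swap1)
qed

lemma smooth_isCont: "smooth f \<Longrightarrow> isCont f x"
  using smooth_has_derivative DERIV_isCont by blast

lemma smooth_affine:
  assumes "smooth f"
  shows "smooth (\<lambda>x. f (m * x + b))"
proof (rule smooth_coinduct[where F = "{\<lambda>x. c * f (m * x + b) | c f. smooth f}"])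
  show "(\<lambda>x. f (m * x + b)) \<in> {\<lambda>x. c * f (m * x + b) | c f. smooth f}"
    using assms by (auto intro!: exI[of _ 1] exI[of _ f])
  fix g assume "g \<in> {\<lambda>x. c * f (m * x + b) | c f. smooth f}"
  then obtain c f where g: "g = (\<lambda>x. c * f (m * x + b))" and f: "smooth f" by blast
  have "(g has_real_derivative c * m * deriv f (m * x + b)) (at x)" for x
    unfolding g
    by (rule DERIV_cong[OF DERIV_cmult[OF DERIV_chain2[OF smooth_has_derivative[OF f]]]])
      (auto intro!: derivative_eq_intros)
  then show "\<exists>g'\<in>{\<lambda>x. c * f (m * x + b) | c f. smooth f}. \<forall>x. (g has_real_derivative g' x) (at x)"
    using smooth_deriv[OF f] by (intro bexI[of _ "\<lambda>x. (c * m) * deriv f (m * x + b)"]) blast+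
qed

text \<open>
  The derivative of a product is a sum of products, so closure under differentiation requires sums.
\<close>
inductive_set smooth_products :: "(real \<Rightarrow> real) set" where
  mult: "smooth f \<Longrightarrow> smooth g \<Longrightarrow> (\<lambda>x. f x * g x) \<in> smooth_products"
| add: "s \<in> smooth_products \<Longrightarrow> t \<in> smooth_products \<Longrightarrow> (\<lambda>x. s x + t x) \<in> smooth_products"

lemma smooth_mult:
  assumes "smooth f" "smooth g"
  shows "smooth (\<lambda>x. f x * g x)"
proof (rule smooth_coinduct)
  show "(\<lambda>x. f x * g x) \<in> smooth_products"
    using assms by (rule smooth_products.mult)
  fix s assume "s \<in> smooth_products"
  then show "\<exists>s'\<in>smooth_products. \<forall>x. (s has_real_derivative s' x) (at x)"
  proof induction
    case (mult f g)
    have "(\<lambda>x. deriv f x * g x + deriv g x * f x) \<in> smooth_products"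
      by (intro smooth_products.intros smooth_deriv mult)
    then show ?case
      using DERIV_mult[OF mult[THEN smooth_has_derivative]]
      by (intro bexI[of _ "\<lambda>x. deriv f x * g x + deriv g x * f x"]) auto
  next
    case (add s t)
    then obtain s' t' where "s' \<in> smooth_products" "t' \<in> smooth_products"
        "\<And>x. (s has_real_derivative s' x) (at x)" "\<And>x. (t has_real_derivative t' x) (at x)"
      by blast
    then show ?case
      by (intro bexI[of _ "\<lambda>x. s' x + t' x"]) (auto intro: DERIV_add smooth_products.add)
  qed
qed

text \<open>
  These functions glue smoothly to zero at the origin, since every power of \<open>1 / x\<close> is beaten by
  \<open>exp (- 1 / x)\<close>. The polynomial factor is there because differentiation only changes that factor.
\<close>
definition flat :: "real poly \<Rightarrow> real \<Rightarrow> real" where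
  "flat P x = (if x > 0 then poly P (1 / x) * exp (- (1 / x)) else 0)"

lemma poly_exp_reciprocal_tendsto_0:
  "((\<lambda>x. poly P (1 / x) * exp (- (1 / x))) \<longlongrightarrow> (0::real)) (at_right 0)"
proof -
  have "((\<lambda>t. \<Sum>i\<le>degree P. coeff P i * (t ^ i / exp t)) \<longlongrightarrow> (\<Sum>i\<le>degree P. coeff P i * 0)) at_top"
    by (intro tendsto_intros tendsto_power_div_exp_0)
  then have "((\<lambda>t. poly P t * exp (- t)) \<longlongrightarrow> 0) at_top"
    by (simp add: poly_altdef sum_distrib_left exp_minus divide_inverse mult_ac)
  from filterlim_compose[OF this filterlim_inverse_at_top_right] show ?thesis
    by (simp add: inverse_eq_divide)
qed

lemma flat_has_derivative:
  "(flat P has_real_derivative flat (monom 1 2 * (P - pderiv P)) x) (at x)"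
proof -
  consider "x > 0" | "x < 0" | "x = 0" by linarith
  then show ?thesis
  proof cases
    case 1
    have "((\<lambda>x. poly P (1 / x) * exp (- (1 / x))) has_real_derivative
        (1 / x)\<^sup>2 * (poly P (1 / x) - poly (pderiv P) (1 / x)) * exp (- (1 / x))) (at x)"
      using 1 by (auto intro!: derivative_eq_intros DERIV_chain2[OF poly_DERIV] simp: field_simps power2_eq_square)
    then have "((\<lambda>x. poly P (1 / x) * exp (- (1 / x))) has_real_derivative
        flat (monom 1 2 * (P - pderiv P)) x) (at x)"
      using 1 by (simp add: flat_def poly_monom mult_ac)
    then show ?thesis
      by (rule has_field_derivative_transform_within_open[of _ _ _ "{0<..}"]) (use 1 in \<open>auto simp: flat_def\<close>)
  next
    case 2
    have "((\<lambda>x. 0) has_real_derivative flat (monom 1 2 * (P - pderiv P)) x) (at x)"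
      using 2 by (simp add: flat_def)
    then show ?thesis
      by (rule has_field_derivative_transform_within_open[of _ _ _ "{..<0}"]) (use 2 in \<open>auto simp: flat_def\<close>)
  next
    case 3
    have "((\<lambda>h. flat P h / h) \<longlongrightarrow> 0) (at_left 0)"
      by (rule tendsto_eventually) (auto simp: flat_def eventually_at_filter)
    moreover have "((\<lambda>h. flat P h / h) \<longlongrightarrow> 0) (at_right 0)"
      by (rule Lim_transform_eventually[OF poly_exp_reciprocal_tendsto_0[of "pCons 0 P"]])
        (auto simp: flat_def eventually_at_filter)
    ultimately show ?thesis
      using 3 by (simp add: DERIV_def flat_def filterlim_split_at)
  qed
qed

lemma smooth_flat: "smooth (flat P)"
proof (rule smooth_coinduct[where F = "range flat"])
  fix f assume "f \<in> range flat"
  then show "\<exists>f'\<in>range flat. \<forall>x. (f has_real_derivative f' x) (at x)"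
    using flat_has_derivative by blast
qed simp

definition bump :: "real \<Rightarrow> real \<Rightarrow> real \<Rightarrow> real" where
  "bump p q x = flat 1 (x - p) * flat 1 (q - x)"

lemma bump_nonneg: "bump p q x \<ge> 0"
  and bump_pos_iff: "bump p q x > 0 \<longleftrightarrow> p < x \<and> x < q"
  and bump_outside: "\<not> (p < x \<and> x < q) \<Longrightarrow> bump p q x = 0"
  by (auto simp: bump_def flat_def)

lemma test_function_iff: "test_function \<phi> \<longleftrightarrow> smooth \<phi> \<and> (\<exists>R. \<forall>x. \<bar>x\<bar> > R \<longrightarrow> \<phi> x = 0)"
  by (simp add: test_function_def smooth_def)

lemma test_function_bump: "test_function (bump p q)"
proof -
  have "smooth (\<lambda>x. flat 1 (1 * x + (- p)) * flat 1 (- 1 * x + q))"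
    by (intro smooth_mult smooth_affine smooth_flat)
  then have "smooth (bump p q)"
    by (simp add: bump_def[abs_def])
  moreover have "\<forall>x. \<bar>x\<bar> > max \<bar>p\<bar> \<bar>q\<bar> \<longrightarrow> bump p q x = 0"
    by (auto intro!: bump_outside)
  ultimately show ?thesis
    unfolding test_function_iff by blast
qed

lemma test_function_deriv:
  assumes "test_function \<phi>"
  shows "test_function (deriv \<phi>)"
proof -
  obtain R where R: "\<And>x. \<bar>x\<bar> > R \<Longrightarrow> \<phi> x = 0"
    using assms by (auto simp: test_function_iff)
  have "deriv \<phi> x = 0" if "\<bar>x\<bar> > R" for x
  proof (rule DERIV_imp_deriv, rule has_field_derivative_transform_within_open)
    show "((\<lambda>x. 0) has_real_derivative 0) (at x)" by simp
    show "open {x. \<bar>x\<bar> > R}"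
      by (intro open_Collect_less continuous_intros)
  qed (use that R in auto)
  then show ?thesis
    using assms smooth_deriv unfolding test_function_iff by blast
qed

lemma test_function_shift:
  assumes "test_function \<phi>"
  shows "test_function (\<lambda>x. \<phi> (x - y))"
proof -
  obtain R where R: "\<And>x. \<bar>x\<bar> > R \<Longrightarrow> \<phi> x = 0"
    using assms by (auto simp: test_function_iff)
  then have "\<forall>x. \<bar>x\<bar> > R + \<bar>y\<bar> \<longrightarrow> \<phi> (x - y) = 0"
    by (auto intro!: R)
  then show ?thesis
    using assms smooth_affine[of \<phi> 1 "- y"] unfolding test_function_iff by auto
qed

lemma test_function_support:
  assumes "test_function \<phi>"
  obtains R where "R > 0" "\<And>x. x \<notin> {-R..R} \<Longrightarrow> \<phi> x = 0"
proof -
  obtain R where "\<And>x. \<bar>x\<bar> > R \<Longrightarrow> \<phi> x = 0"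
    using assms by (auto simp: test_function_iff)
  then show thesis
    by (intro that[of "\<bar>R\<bar> + 1"]) auto
qed

lemma test_function_derivative: "test_function \<phi> \<Longrightarrow> (\<phi> has_real_derivative deriv \<phi> x) (at x)"
  and test_function_continuous_on: "test_function \<phi> \<Longrightarrow> continuous_on S \<phi>"
  by (auto simp: test_function_iff intro: smooth_has_derivative smooth_isCont continuous_at_imp_continuous_on)

lemma deriv_shift:
  assumes "test_function \<phi>"
  shows "deriv (\<lambda>x. \<phi> (x - y)) = (\<lambda>x. deriv \<phi> (x - y))"
proof (rule ext, rule DERIV_imp_deriv)
  fix x
  show "((\<lambda>x. \<phi> (x - y)) has_real_derivative deriv \<phi> (x - y)) (at x)"
    by (rule DERIV_cong[OF DERIV_chain2[OF test_function_derivative[OF assms]]])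
      (auto intro!: derivative_eq_intros)
qed

lemma lborel_integral_compact_support:
  fixes f :: "real \<Rightarrow> real"
  assumes "continuous_on {a..b} f" and outside: "\<And>x. x \<notin> {a..b} \<Longrightarrow> f x = 0"
  shows "integrable lborel f" and "integral\<^sup>L lborel f = integral {a..b} f"
proof -
  have f: "f = (\<lambda>x. indicator {a..b} x *\<^sub>R f x)"
    using outside by (auto simp: indicator_def fun_eq_iff)
  have *: "set_integrable lborel {a..b} f"
    by (rule borel_integrable_atLeastAtMost'[OF assms(1)])
  show "integrable lborel f"
    by (subst f) (use * in \<open>simp add: set_integrable_def\<close>)
  have "integral\<^sup>L lborel f = (LINT x:{a..b}|lborel. f x)"
    unfolding set_lebesgue_integral_def by (subst f) simp
  then show "integral\<^sup>L lborel f = integral {a..b} f"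
    using set_borel_integral_eq_integral(2)[OF *] by simp
qed

lemma integrable_mult_test_function:
  assumes "continuous_on UNIV f" "test_function \<phi>"
  shows "integrable lborel (\<lambda>x. f x * \<phi> x)"
proof -
  obtain R where R: "R > 0" "\<And>x. x \<notin> {-R..R} \<Longrightarrow> \<phi> x = 0"
    using test_function_support[OF assms(2)] by blast
  show ?thesis
    by (rule lborel_integral_compact_support[of "-R" R])
      (use R in \<open>auto intro!: continuous_intros continuous_on_subset[OF assms(1)] test_function_continuous_on[OF assms(2)]\<close>)
qed

text \<open>
  Where \<open>g\<close> is positive it is so on a whole interval, and a bump supported in that interval would have a
  positive integral against \<open>g\<close>.
\<close>
lemma not_pos_if_orthogonal_to_test_functions:
  assumes g: "continuous_on UNIV g" and orth: "\<And>\<phi>. test_function \<phi> \<Longrightarrow> (LINT x|lborel. g x * \<phi> x) = 0"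
  shows "\<not> g x0 > 0"
proof
  assume "g x0 > 0"
  then have "\<forall>\<^sub>F x in nhds x0. g x > 0"
    using g order_tendstoD(1)[of g "g x0" "nhds x0" 0]
    by (simp add: continuous_on_eq_continuous_at isCont_def tendsto_at_iff_tendsto_nhds)
  then obtain \<delta> where \<delta>: "\<delta> > 0" "\<And>x. dist x x0 < \<delta> \<Longrightarrow> g x > 0"
    unfolding eventually_nhds_metric by blast
  let ?p = "x0 - \<delta>" and ?q = "x0 + \<delta>"
  let ?f = "\<lambda>x. g x * bump ?p ?q x"
  have cont: "continuous_on {?p..?q} ?f"
    by (intro continuous_intros continuous_on_subset[OF g] test_function_continuous_on test_function_bump) auto
  have nonneg: "?f x \<ge> 0" for x
    using \<delta>(2)[of x] bump_nonneg[of ?p ?q x] bump_outside[of ?p x ?q] by (cases "dist x x0 < \<delta>") (auto simp: dist_real_def abs_less_iff)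
  have "integral {?p..?q} ?f = 0"
  proof -
    have "?f x = 0" if "x \<notin> {?p..?q}" for x
      using that bump_outside[of ?p x ?q] by auto
    then show ?thesis
      using orth[OF test_function_bump, of ?p ?q] lborel_integral_compact_support(2)[OF cont] by simp
  qed
  then have "?f x0 = 0"
    using integral_eq_0_iff[OF cont] nonneg \<delta>(1) by auto
  then show False
    using \<open>g x0 > 0\<close> bump_pos_iff[of ?p ?q x0] \<delta>(1) by auto
qed

lemma regular_eq_imp_eq:
  assumes f: "continuous_on UNIV f" and g: "continuous_on UNIV g" and eq: "regular f \<simeq>\<^sub>D regular g"
  shows "f x = g x"
proof -
  have orth: "(LINT x|lborel. (f x - g x) * \<phi> x) = 0" "(LINT x|lborel. (g x - f x) * \<phi> x) = 0"
    if "test_function \<phi>" for \<phi>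
  proof -
    note int = integrable_mult_test_function[OF f that] integrable_mult_test_function[OF g that]
    have "(LINT x|lborel. f x * \<phi> x) = (LINT x|lborel. g x * \<phi> x)"
      using eq that by (simp add: eq_distribution_def regular_def)
    with int show "(LINT x|lborel. (f x - g x) * \<phi> x) = 0" "(LINT x|lborel. (g x - f x) * \<phi> x) = 0"
      by (simp_all add: left_diff_distrib)
  qed
  have "\<not> f x - g x > 0" "\<not> g x - f x > 0"
    using not_pos_if_orthogonal_to_test_functions[of "\<lambda>x. f x - g x" x] not_pos_if_orthogonal_to_test_functions[of "\<lambda>x. g x - f x" x] orth
      continuous_on_diff[OF f g] continuous_on_diff[OF g f] by blast+
  then show ?thesis by simp
qed


section \<open>Weak solutions with a point source\<close>

text \<open>
  Correlation with a test function makes the solutions of a weak differential equation smooth, and its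
  value at the origin is the pairing of \<open>z\<close> with the test function.
\<close>
definition correlate :: "(real \<Rightarrow> real) \<Rightarrow> (real \<Rightarrow> real) \<Rightarrow> real \<Rightarrow> real" where
  "correlate z \<phi> y = (LINT x|lborel. z x * \<phi> (x - y))"

lemma correlate_has_derivative:
  assumes z: "continuous_on UNIV z" and \<phi>: "test_function \<phi>"
  shows "(correlate z \<phi> has_real_derivative - correlate z (deriv \<phi>) y) (at y)"
proof -
  obtain R1 where R1: "R1 > 0" "\<And>x. x \<notin> {-R1..R1} \<Longrightarrow> \<phi> x = 0"
    using test_function_support[OF \<phi>] by blast
  obtain R2 where R2: "R2 > 0" "\<And>x. x \<notin> {-R2..R2} \<Longrightarrow> deriv \<phi> x = 0"
    using test_function_support[OF test_function_deriv[OF \<phi>]] by blast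
  define R where "R = max R1 R2"
  let ?A = "y - 1 - R" and ?B = "y + 1 + R" and ?U = "{y - 1<..<y + 1}"
  have as_integral: "correlate z \<psi> t = integral {?A..?B} (\<lambda>x. z x * \<psi> (x - t))"
    if "test_function \<psi>" "\<And>x. x \<notin> {-R..R} \<Longrightarrow> \<psi> x = 0" "t \<in> ?U" for \<psi> t
    unfolding correlate_def
  proof (rule lborel_integral_compact_support(2))
    show "continuous_on {?A..?B} (\<lambda>x. z x * \<psi> (x - t))"
      by (intro continuous_intros continuous_on_subset[OF z] test_function_continuous_on test_function_shift that) auto
    fix x assume "x \<notin> {?A..?B}"
    then show "z x * \<psi> (x - t) = 0"
      using that(2)[of "x - t"] that(3) by auto
  qed
  have "((\<lambda>t. integral (cbox ?A ?B) (\<lambda>x. z x * \<phi> (x - t))) has_real_derivative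
      integral (cbox ?A ?B) (\<lambda>x. - (z x * deriv \<phi> (x - y)))) (at y within ?U)"
  proof (rule leibniz_rule_field_derivative)
    fix t x
    show "((\<lambda>t. z x * \<phi> (x - t)) has_real_derivative - (z x * deriv \<phi> (x - t))) (at t within ?U)"
      by (rule has_field_derivative_at_within,
          rule DERIV_cong[OF DERIV_cmult[OF DERIV_chain2[OF test_function_derivative[OF \<phi>]]]])
        (auto intro!: derivative_eq_intros)
    show "(\<lambda>x. z x * \<phi> (x - t)) integrable_on cbox ?A ?B"
      by (intro integrable_continuous continuous_intros continuous_on_subset[OF z] test_function_continuous_on test_function_shift \<phi>) auto
  next
    have "continuous_on (?U \<times> cbox ?A ?B) (\<lambda>p. - (z (snd p) * deriv \<phi> (snd p - fst p)))"
      by (intro continuous_intros continuous_on_compose2[OF z] 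
          continuous_on_compose2[OF test_function_continuous_on[OF test_function_deriv[OF \<phi>], of UNIV]]) auto
    then show "continuous_on (?U \<times> cbox ?A ?B) (\<lambda>(t, x). - (z x * deriv \<phi> (x - t)))"
      by (simp add: case_prod_unfold)
  qed auto
  then have "((\<lambda>t. integral {?A..?B} (\<lambda>x. z x * \<phi> (x - t))) has_real_derivative
      - integral {?A..?B} (\<lambda>x. z x * deriv \<phi> (x - y))) (at y)"
    by (simp add: at_within_open[of y ?U])
  then have "(correlate z \<phi> has_real_derivative - integral {?A..?B} (\<lambda>x. z x * deriv \<phi> (x - y))) (at y)"
  proof (rule has_field_derivative_transform_within_open)
    have "\<phi> x = 0" if "x \<notin> {-R..R}" for x
      by (rule R1(2)) (use that in \<open>auto simp: R_def\<close>)
    then show "integral {?A..?B} (\<lambda>x. z x * \<phi> (x - t)) = correlate z \<phi> t" if "t \<in> ?U" for t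
      using as_integral[OF \<phi>] that by simp
  qed auto
  moreover have "correlate z (deriv \<phi>) y = integral {?A..?B} (\<lambda>x. z x * deriv \<phi> (x - y))"
  proof (rule as_integral[OF test_function_deriv[OF \<phi>]])
    show "deriv \<phi> x = 0" if "x \<notin> {-R..R}" for x
      by (rule R2(2)) (use that in \<open>auto simp: R_def\<close>)
  qed simp
  ultimately show ?thesis by simp
qed

lemma correlate_bounded:
  assumes z: "continuous_on UNIV z" "bounded (range z)" and \<phi>: "test_function \<phi>"
  shows "\<exists>K. \<forall>y. \<bar>correlate z \<phi> y\<bar> \<le> K"
proof -
  obtain R where R: "R > 0" "\<And>x. x \<notin> {-R..R} \<Longrightarrow> \<phi> x = 0"
    using test_function_support[OF \<phi>] by blast
  obtain C where C: "\<And>x. \<bar>z x\<bar> \<le> C"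
    using z(2) by (auto simp: bounded_iff)
  have "bounded (\<phi> ` {-R..R})"
    by (intro compact_imp_bounded compact_continuous_image test_function_continuous_on \<phi>) simp
  then have "\<exists>D. \<forall>x\<in>{-R..R}. \<bar>\<phi> x\<bar> \<le> D"
    by (simp add: bounded_iff)
  then obtain D where D: "\<And>x. x \<in> {-R..R} \<Longrightarrow> \<bar>\<phi> x\<bar> \<le> D"
    by blast
  have "\<bar>correlate z \<phi> y\<bar> \<le> C * D * (y + R - (y - R))" for y
  proof -
    have cont: "continuous_on {y - R..y + R} (\<lambda>x. z x * \<phi> (x - y))"
      by (intro continuous_intros continuous_on_subset[OF z(1)] test_function_continuous_on test_function_shift \<phi>) auto
    have "correlate z \<phi> y = integral {y - R..y + R} (\<lambda>x. z x * \<phi> (x - y))"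
      unfolding correlate_def by (rule lborel_integral_compact_support(2)[OF cont]) (use R(2) in auto)
    moreover have "norm (integral {y - R..y + R} (\<lambda>x. z x * \<phi> (x - y))) \<le> C * D * (y + R - (y - R))"
    proof (rule integral_bound[OF _ cont])
      fix x assume "x \<in> {y - R..y + R}"
      then show "norm (z x * \<phi> (x - y)) \<le> C * D"
        using C[of x] D[of "x - y"] order_trans[OF abs_ge_zero C] by (auto simp: abs_mult intro!: mult_mono)
    qed (use R in simp)
    ultimately show ?thesis by simp
  qed
  then show ?thesis by auto
qed

text \<open>
  The correlation \<open>Z\<close> of \<open>z\<close> with a test function is a classical solution of \<open>Z'' = l\<^sup>2 Z\<close>, hence a
  combination of \<open>exp (l y)\<close> and \<open>exp (- l y)\<close>. It is bounded because \<open>z\<close> is, which is impossible unless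
  both coefficients vanish.
\<close>
lemma bounded_weak_solution_zero:
  assumes z: "continuous_on UNIV z" "bounded (range z)" and "l > 0"
    and weak: "\<And>\<phi>. test_function \<phi> \<Longrightarrow>
      (LINT x|lborel. z x * deriv (deriv \<phi>) x) = l\<^sup>2 * (LINT x|lborel. z x * \<phi> x)"
  shows "z x = 0"
proof -
  have orth: "(LINT x|lborel. z x * \<phi> x) = 0" if \<phi>: "test_function \<phi>" for \<phi>
  proof -
    let ?Z = "correlate z \<phi>" and ?D = "correlate z (deriv \<phi>)"
    note \<phi>' = test_function_deriv[OF \<phi>]
    have "correlate z (deriv (deriv \<phi>)) y = l\<^sup>2 * ?Z y" for y
      using weak[OF test_function_shift[OF \<phi>, of y]]
      by (simp add: correlate_def deriv_shift \<phi> \<phi>')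
    then have Z': "(?Z has_real_derivative - ?D y) (at y)" and D': "(?D has_real_derivative - (l\<^sup>2 * ?Z y)) (at y)" for y
      using correlate_has_derivative[OF z(1) \<phi>] correlate_has_derivative[OF z(1) \<phi>'] by metis+
    \<comment> \<open>As \<open>?D = - ?Z'\<close>, the conserved quantity is \<open>2 s\<close> times the coefficient of \<open>exp (- s y)\<close> in \<open>?Z\<close>.\<close>
    have conserved: "exp (s * y) * (?D y + s * ?Z y) = ?D 0 + s * ?Z 0" if "s\<^sup>2 = l\<^sup>2" for s y
    proof -
      have "((\<lambda>y. exp (s * y) * (?D y + s * ?Z y)) has_real_derivative 0) (at y)" for y
      proof -
        have "((\<lambda>y. exp (s * y) * (?D y + s * ?Z y)) has_real_derivative
          exp (s * y) * s * (?D y + s * ?Z y) + exp (s * y) * (- (l\<^sup>2 * ?Z y) + s * (- ?D y))) (at y)"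
          by (auto intro!: derivative_eq_intros Z' D')
        then show ?thesis
          by (rule DERIV_cong) (simp add: algebra_simps power2_eq_square that[unfolded power2_eq_square, symmetric])
      qed
      then show ?thesis
        using DERIV_isconst_all[of "\<lambda>y. exp (s * y) * (?D y + s * ?Z y)" y 0] by simp
    qed
    obtain K1 K2 where K: "\<And>y. \<bar>?Z y\<bar> \<le> K1" "\<And>y. \<bar>?D y\<bar> \<le> K2"
      using correlate_bounded[OF z \<phi>] correlate_bounded[OF z \<phi>'] by blast
    \<comment> \<open>A nonzero conserved quantity contradicts boundedness where \<open>exp (s y)\<close> is small.\<close>
    have vanish: "?D 0 + s * ?Z 0 = 0" if s: "s\<^sup>2 = l\<^sup>2" for s
    proof (rule ccontr)
      assume nz: "?D 0 + s * ?Z 0 \<noteq> 0"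
      define c where "c = \<bar>?D 0 + s * ?Z 0\<bar>"
      define K where "K = K2 + \<bar>s\<bar> * K1"
      have "c > 0" "s \<noteq> 0"
        using nz s \<open>l > 0\<close> by (auto simp: c_def)
      have le: "c \<le> exp (s * y) * K" for y
      proof -
        have "\<bar>?D y + s * ?Z y\<bar> \<le> \<bar>?D y\<bar> + \<bar>s\<bar> * \<bar>?Z y\<bar>"
          by (metis abs_mult abs_triangle_ineq)
        also have "\<dots> \<le> K"
          unfolding K_def by (intro add_mono mult_left_mono K) simp
        finally show ?thesis
          unfolding c_def conserved[OF s, of y, symmetric] by (simp add: abs_mult)
      qed
      have "K > 0"
        using le[of 0] \<open>c > 0\<close> by simp
      then have "exp (s * (ln (c / (2 * K)) / s)) * K = c / 2"
        using \<open>c > 0\<close> \<open>s \<noteq> 0\<close> by simp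
      then show False
        using le[of "ln (c / (2 * K)) / s"] \<open>c > 0\<close> by simp
    qed
    have "?D 0 + l * ?Z 0 = 0" "?D 0 + (- l) * ?Z 0 = 0"
      by (intro vanish; simp)+
    then have "?Z 0 = 0"
      using \<open>l > 0\<close> by simp
    then show ?thesis
      by (simp add: correlate_def)
  qed
  have "(LINT x|lborel. - z x * \<phi> x) = 0" if \<phi>: "test_function \<phi>" for \<phi>
    using orth[OF that] by simp
  then have "\<not> z x > 0" "\<not> - z x > 0"
    using not_pos_if_orthogonal_to_test_functions[OF z(1) orth] not_pos_if_orthogonal_to_test_functions[of "\<lambda>x. - z x"]
      continuous_on_minus[OF z(1)] by blast+
  then show ?thesis by simp
qed


lemma continuous_decaying_bounded:
  assumes "continuous_decaying f"
  shows "bounded (range f)"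
proof -
  have "\<forall>\<^sub>F x in at_top. \<bar>f x\<bar> < 1" "\<forall>\<^sub>F x in at_bot. \<bar>f x\<bar> < 1"
    using assms tendsto_rabs[of f 0] order_tendstoD(2)[of "\<lambda>x. \<bar>f x\<bar>" 0 _ 1]
    unfolding continuous_decaying_def by auto
  then obtain p q where p: "\<And>x. x \<ge> p \<Longrightarrow> \<bar>f x\<bar> < 1" and q: "\<And>x. x \<le> q \<Longrightarrow> \<bar>f x\<bar> < 1"
    unfolding eventually_at_top_linorder eventually_at_bot_linorder by blast
  have "bounded (f ` {q..p})"
    using assms unfolding continuous_decaying_def
    by (intro compact_imp_bounded compact_continuous_image) (auto intro: continuous_on_subset)
  then obtain C where "\<forall>x\<in>{q..p}. \<bar>f x\<bar> \<le> C"
    unfolding bounded_iff by auto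
  moreover have "x \<in> {q..p} \<or> p \<le> x \<or> x \<le> q" for x
    by auto
  ultimately have "\<bar>f x\<bar> \<le> max C 1" for x
    using p q by (meson less_imp_le max.coboundedI1 max.coboundedI2)
  then show ?thesis
    unfolding bounded_iff by auto
qed

text \<open>
  On either side of the origin \<open>exp (s x) (\<phi>' - s \<phi>)\<close> with \<open>s = l\<close> or \<open>s = - l\<close> is a primitive of the integrand
  \<open>exp (s x) (\<phi>'' - l\<^sup>2 \<phi>)\<close>. In the sum of the two halves \<open>\<phi>' 0\<close> cancels and \<open>- 2 l \<phi> 0\<close> remains.
\<close>
lemma exp_abs_weak_solution:
  assumes "l > 0" and \<phi>: "test_function \<phi>"
  shows "(LINT x|lborel. exp (- l * \<bar>x\<bar>) * deriv (deriv \<phi>) x)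
       = l\<^sup>2 * (LINT x|lborel. exp (- l * \<bar>x\<bar>) * \<phi> x) - 2 * l * \<phi> 0"
proof -
  note \<phi>' = test_function_deriv[OF \<phi>]
  note \<phi>'' = test_function_deriv[OF \<phi>']
  have cont: "continuous_on UNIV (\<lambda>x. exp (- l * \<bar>x\<bar>))"
    by (intro continuous_intros)
  let ?f = "\<lambda>x. exp (- l * \<bar>x\<bar>) * (deriv (deriv \<phi>) x - l\<^sup>2 * \<phi> x)"
  obtain R0 where R0: "\<And>x. x \<notin> {-R0..R0} \<Longrightarrow> \<phi> x = 0"
    using test_function_support[OF \<phi>] by blast
  obtain R1 where R1: "\<And>x. x \<notin> {-R1..R1} \<Longrightarrow> deriv \<phi> x = 0"
    using test_function_support[OF \<phi>'] by blast
  obtain R2 where R2: "\<And>x. x \<notin> {-R2..R2} \<Longrightarrow> deriv (deriv \<phi>) x = 0"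
    using test_function_support[OF \<phi>''] by blast
  define R where "R = 1 + \<bar>R0\<bar> + \<bar>R1\<bar> + \<bar>R2\<bar>"
  have "R > 0" by (simp add: R_def)
  have outside: "?f x = 0" if "x \<notin> {-R..R}" for x
  proof -
    have "x \<notin> {-R0..R0}" "x \<notin> {-R2..R2}"
      using that by (auto simp: R_def)
    then show ?thesis using R0 R2 by simp
  qed
  have ends: "\<phi> R = 0" "\<phi> (-R) = 0" "deriv \<phi> R = 0" "deriv \<phi> (-R) = 0"
  proof -
    have "R \<notin> {-R0..R0}" "-R \<notin> {-R0..R0}" "R \<notin> {-R1..R1}" "-R \<notin> {-R1..R1}"
      by (auto simp: R_def)
    then show "\<phi> R = 0" "\<phi> (-R) = 0" "deriv \<phi> R = 0" "deriv \<phi> (-R) = 0"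
      using R0 R1 by blast+
  qed
  have f_cont: "continuous_on S ?f" for S
    by (intro continuous_intros test_function_continuous_on \<phi> \<phi>'')
  have half: "((\<lambda>x. exp (s * x) * (deriv (deriv \<phi>) x - l\<^sup>2 * \<phi> x)) has_integral
      exp (s * q) * (deriv \<phi> q - s * \<phi> q) - exp (s * p) * (deriv \<phi> p - s * \<phi> p)) {p..q}"
    if "s\<^sup>2 = l\<^sup>2" "p \<le> q" for s p q
  proof (rule fundamental_theorem_of_calculus[OF \<open>p \<le> q\<close>])
    fix x
    have "((\<lambda>x. exp (s * x) * (deriv \<phi> x - s * \<phi> x)) has_real_derivative
        exp (s * x) * s * (deriv \<phi> x - s * \<phi> x) + exp (s * x) * (deriv (deriv \<phi>) x - s * deriv \<phi> x)) (at x within {p..q})"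
      by (auto intro!: derivative_eq_intros test_function_derivative[OF \<phi>', THEN has_field_derivative_at_within]
          test_function_derivative[OF \<phi>, THEN has_field_derivative_at_within])
    then have "((\<lambda>x. exp (s * x) * (deriv \<phi> x - s * \<phi> x)) has_real_derivative
        exp (s * x) * (deriv (deriv \<phi>) x - l\<^sup>2 * \<phi> x)) (at x within {p..q})"
      by (rule DERIV_cong) (simp add: algebra_simps power2_eq_square that(1)[unfolded power2_eq_square, symmetric])
    then show "((\<lambda>x. exp (s * x) * (deriv \<phi> x - s * \<phi> x)) has_vector_derivative
        exp (s * x) * (deriv (deriv \<phi>) x - l\<^sup>2 * \<phi> x)) (at x within {p..q})"
      by (simp add: has_real_derivative_iff_has_vector_derivative)
  qed
  have left: "(?f has_integral deriv \<phi> 0 - l * \<phi> 0) {-R..0}"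
  proof (rule has_integral_eq)
    show "((\<lambda>x. exp (l * x) * (deriv (deriv \<phi>) x - l\<^sup>2 * \<phi> x)) has_integral deriv \<phi> 0 - l * \<phi> 0) {-R..0}"
      using half[of l "-R" 0] \<open>R > 0\<close> by (simp add: ends)
  qed simp
  have right: "(?f has_integral - (deriv \<phi> 0 + l * \<phi> 0)) {0..R}"
  proof (rule has_integral_eq)
    show "((\<lambda>x. exp (- l * x) * (deriv (deriv \<phi>) x - l\<^sup>2 * \<phi> x)) has_integral - (deriv \<phi> 0 + l * \<phi> 0)) {0..R}"
      using half[of "- l" 0 R] \<open>R > 0\<close> by (simp add: ends)
  qed simp
  have whole: "(?f has_integral deriv \<phi> 0 - l * \<phi> 0 + - (deriv \<phi> 0 + l * \<phi> 0)) {-R..R}"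
    by (rule has_integral_combine[OF _ _ left right]) (use \<open>R > 0\<close> in auto)
  have "integral\<^sup>L lborel ?f = integral {-R..R} ?f"
    by (rule lborel_integral_compact_support(2)[OF f_cont outside])
  also have "\<dots> = deriv \<phi> 0 - l * \<phi> 0 + - (deriv \<phi> 0 + l * \<phi> 0)"
    by (rule integral_unique[OF whole])
  finally have "integral\<^sup>L lborel ?f = - 2 * l * \<phi> 0"
    by simp
  moreover have "integral\<^sup>L lborel ?f =
      (LINT x|lborel. exp (- l * \<bar>x\<bar>) * deriv (deriv \<phi>) x) - l\<^sup>2 * (LINT x|lborel. exp (- l * \<bar>x\<bar>) * \<phi> x)"
  proof -
    have "?f = (\<lambda>x. exp (- l * \<bar>x\<bar>) * deriv (deriv \<phi>) x - l\<^sup>2 * (exp (- l * \<bar>x\<bar>) * \<phi> x))"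
      by (simp add: fun_eq_iff algebra_simps)
    then show ?thesis
      using integrable_mult_test_function[OF cont \<phi>''] integrable_mult_test_function[OF cont \<phi>] by simp
  qed
  ultimately show ?thesis by simp
qed

text \<open>
  The constant is determined by the kink of the exponential, and the difference of \<open>w\<close> and that
  exponential is a bounded weak solution without source.
\<close>
lemma weak_solution_with_point_source:
  assumes w: "continuous_decaying w" and "l > 0"
    and weak: "\<And>\<phi>. test_function \<phi> \<Longrightarrow>
      (LINT x|lborel. w x * deriv (deriv \<phi>) x) = l\<^sup>2 * (LINT x|lborel. w x * \<phi> x) - \<kappa> * \<phi> 0"
  shows "w x = \<kappa> / (2 * l) * exp (- l * \<bar>x\<bar>)"
proof -
  define e where "e x = exp (- l * \<bar>x\<bar>)" for x
  define k where "k = \<kappa> / (2 * l)"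
  have \<kappa>: "\<kappa> = 2 * l * k"
    using \<open>l > 0\<close> by (simp add: k_def)
  let ?z = "\<lambda>x. w x - k * e x"
  have w_cont: "continuous_on UNIV w"
    using w by (simp add: continuous_decaying_def)
  have e_cont: "continuous_on UNIV e"
    unfolding e_def by (intro continuous_intros)
  have "continuous_on UNIV ?z"
    by (intro continuous_intros w_cont e_cont)
  moreover have "bounded (range ?z)"
  proof -
    have "norm (e x) \<le> 1" for x
      using \<open>l > 0\<close> by (simp add: e_def)
    then have "bounded (range e)"
      unfolding bounded_iff by blast
    from bounded_minus_comp[OF continuous_decaying_bounded[OF w] bounded_scaleR_comp[OF this, of k]]
    show ?thesis by simp
  qed
  moreover have "(LINT x|lborel. ?z x * deriv (deriv \<phi>) x) = l\<^sup>2 * (LINT x|lborel. ?z x * \<phi> x)"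
    if \<phi>: "test_function \<phi>" for \<phi>
  proof -
    have split: "(LINT x|lborel. ?z x * \<psi> x) = (LINT x|lborel. w x * \<psi> x) - k * (LINT x|lborel. e x * \<psi> x)"
      if "test_function \<psi>" for \<psi>
      using integrable_mult_test_function[OF w_cont that] integrable_mult_test_function[OF e_cont that]
      by (simp add: left_diff_distrib mult.assoc)
    have arith: "C - k * A = l\<^sup>2 * (D - k * B)"
      if "A = l\<^sup>2 * B - 2 * l * p" and "C = l\<^sup>2 * D - \<kappa> * p" for A B C D p
      unfolding that \<kappa> by (simp add: algebra_simps)
    show ?thesis
      unfolding split[OF \<phi>] split[OF test_function_deriv[OF test_function_deriv[OF \<phi>]]]
      by (rule arith[OF exp_abs_weak_solution[OF \<open>l > 0\<close> \<phi>, folded e_def] weak[OF \<phi>]])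
  qed
  ultimately have "?z x = 0"
    by (rule bounded_weak_solution_zero[OF _ _ \<open>l > 0\<close>])
  then show ?thesis
    by (simp add: e_def k_def)
qed

section \<open>Existence of solutions of the wave equation\<close>

text \<open>
  One of the two integrals is over an empty or a one-point interval. This is the integral from \<open>x0\<close> to \<open>x\<close>
  with its sign.
\<close>
definition primitive :: "real \<Rightarrow> (real \<Rightarrow> 'a::euclidean_space) \<Rightarrow> real \<Rightarrow> 'a" where
  "primitive x0 f x = integral {x0..x} f - integral {x..x0} f"

lemma primitive_at_base [simp]: "primitive x0 f x0 = 0"
  by (simp add: primitive_def)

lemma primitive_add_integral:
  fixes f :: "real \<Rightarrow> 'a::euclidean_space"
  assumes f: "\<And>a b. f integrable_on {a..b}" and "x \<le> y"
  shows "primitive x0 f y = primitive x0 f x + integral {x..y} f"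
proof -
  have degenerate: "integral {p..q} f = 0" if "q \<le> p" for p q
    using that by (cases "p = q") auto
  have combine: "integral {p..q} f + integral {q..s} f = integral {p..s} f" if "p \<le> q" "q \<le> s" for p q s
    using Henstock_Kurzweil_Integration.integral_combine[OF that f] .
  consider "x0 \<le> x" | "x \<le> x0" "x0 \<le> y" | "y \<le> x0"
    by linarith
  then show ?thesis
  proof cases
    case 1
    then show ?thesis
      using combine[of x0 x y] degenerate[of x0 x] degenerate[of x0 y] \<open>x \<le> y\<close>
      by (simp add: primitive_def)
  next
    case 2
    then show ?thesis
      using combine[OF 2] degenerate[OF 2(1)] degenerate[OF 2(2)]
      by (simp add: primitive_def algebra_simps)
  next
    case 3
    then show ?thesis
      using combine[of x y x0] degenerate[of x x0] degenerate[of y x0] \<open>x \<le> y\<close>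
      by (simp add: primitive_def algebra_simps)
  qed
qed

lemma continuous_on_primitive:
  fixes f :: "real \<Rightarrow> 'a::euclidean_space"
  assumes f: "\<And>a b. f integrable_on {a..b}"
  shows "continuous_on UNIV (primitive x0 f)"
proof -
  have "isCont (primitive x0 f) x" for x
  proof -
    have "continuous_on {x - 1..x + 1} (\<lambda>y. primitive x0 f (x - 1) + integral {x - 1..y} f)"
      by (intro continuous_intros indefinite_integral_continuous_1 f)
    then have "continuous_on {x - 1..x + 1} (primitive x0 f)"
      by (rule continuous_on_eq) (simp add: primitive_add_integral[OF f, symmetric])
    then show ?thesis
      by (rule continuous_on_interior) simp
  qed
  then show ?thesis
    by (simp add: continuous_at_imp_continuous_on)
qed

lemma primitive_has_vector_derivative:
  fixes f :: "real \<Rightarrow> 'a::euclidean_space"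
  assumes f: "\<And>a b. f integrable_on {a..b}" and "isCont f x"
  shows "(primitive x0 f has_vector_derivative f x) (at x)"
proof -
  have "((\<lambda>y. integral {x - 1..y} f) has_vector_derivative f x) (at x within {x - 1..x + 1} - {})"
    by (rule integral_has_vector_derivative_continuous_at[OF f])
      (use \<open>isCont f x\<close> in \<open>auto intro: continuous_at_imp_continuous_at_within\<close>)
  then have "((\<lambda>y. integral {x - 1..y} f) has_vector_derivative f x) (at x)"
    by (simp add: at_within_Icc_at)
  then have "((\<lambda>y. primitive x0 f (x - 1) + integral {x - 1..y} f) has_vector_derivative f x) (at x)"
    by (auto intro!: derivative_eq_intros)
  then show ?thesis
    by (rule has_vector_derivative_transform_within_open[where S = "{x - 1<..<x + 1}"])
      (simp_all add: primitive_add_integral[OF f, symmetric])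
qed

text \<open>
  In a supremum norm with weight \<open>exp (- L \<bar>x - x0\<bar>)\<close>, taking primitives has operator norm at most \<open>1 / L\<close>.
\<close>
lemma norm_primitive_le_exp:
  fixes f :: "real \<Rightarrow> 'a::euclidean_space"
  assumes f: "\<And>a b. f integrable_on {a..b}" and "L > 0"
    and bound: "\<And>t. norm (f t) \<le> K * exp (L * \<bar>t - x0\<bar>)"
  shows "norm (primitive x0 f x) \<le> K / L * exp (L * \<bar>x - x0\<bar>)"
proof -
  have "0 \<le> K"
    using order_trans[OF norm_ge_zero bound[of x0]] by simp
  show ?thesis
  proof (cases "x0 \<le> x")
    case True
    let ?F = "\<lambda>t. K / L * exp (L * (t - x0))"
    let ?g = "\<lambda>t. K * exp (L * (t - x0))"
    have "(?F has_real_derivative ?g t) (at t within {x0..x})" for t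
      using \<open>L > 0\<close> by (auto intro!: derivative_eq_intros)
    then have "(?g has_integral ?F x - ?F x0) {x0..x}"
      by (intro fundamental_theorem_of_calculus True) (simp add: has_real_derivative_iff_has_vector_derivative)
    then have integral_g: "integral {x0..x} ?g = ?F x - ?F x0" and g: "?g integrable_on {x0..x}"
      by (rule integral_unique, rule has_integral_integrable)
    have "norm (f t) \<le> ?g t" if "t \<in> {x0..x}" for t
      using bound[of t] that by simp
    then have "norm (integral {x0..x} f) \<le> integral {x0..x} ?g"
      by (intro integral_norm_bound_integral f g)
    also have "\<dots> \<le> K / L * exp (L * (x - x0))"
      unfolding integral_g using \<open>0 \<le> K\<close> \<open>L > 0\<close> by simp
    finally show ?thesis
      using True by (cases "x = x0") (simp_all add: primitive_def)
  next
    case False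
    then have le: "x \<le> x0" by simp
    let ?F = "\<lambda>t. - (K / L) * exp (L * (x0 - t))"
    let ?g = "\<lambda>t. K * exp (L * (x0 - t))"
    have "(?F has_real_derivative ?g t) (at t within {x..x0})" for t
      using \<open>L > 0\<close> by (auto intro!: derivative_eq_intros)
    then have "(?g has_integral ?F x0 - ?F x) {x..x0}"
      by (intro fundamental_theorem_of_calculus le) (simp add: has_real_derivative_iff_has_vector_derivative)
    then have integral_g: "integral {x..x0} ?g = ?F x0 - ?F x" and g: "?g integrable_on {x..x0}"
      by (rule integral_unique, rule has_integral_integrable)
    have "norm (f t) \<le> ?g t" if "t \<in> {x..x0}" for t
      using bound[of t] that by (simp add: abs_of_nonpos)
    then have "norm (integral {x..x0} f) \<le> integral {x..x0} ?g"
      by (intro integral_norm_bound_integral f g)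
    also have "\<dots> \<le> K / L * exp (L * (x0 - x))"
      unfolding integral_g using \<open>0 \<le> K\<close> \<open>L > 0\<close> by simp
    finally show ?thesis
      using False by (simp add: primitive_def)
  qed
qed

lemma borel_measurable_imp_integrable_Icc:
  fixes f :: "real \<Rightarrow> 'a::euclidean_space"
  assumes "f \<in> borel_measurable borel" and "continuous_on UNIV g" and "\<And>t. norm (f t) \<le> g t"
  shows "f integrable_on {a..b}"
proof (rule measurable_bounded_by_integrable_imp_integrable)
  show "f \<in> borel_measurable (lebesgue_on {a..b})"
    using assms(1) by (intro measurable_restrict_space1 measurable_completion) simp
  show "g integrable_on {a..b}"
    by (rule integrable_continuous_interval, rule continuous_on_subset[OF assms(2)]) simp
qed (use assms in auto)

text \<open>
  The coefficient may be discontinuous, so the equation is solved in integrated form. The solution is the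
  fixed point of a contraction on the bounded continuous functions, after division by a weight that grows
  fast enough to make the map contract on the whole line at once.
\<close>
lemma linear_volterra_solution_exists:
  fixes F :: "real \<Rightarrow> 'a::euclidean_space \<Rightarrow> 'a"
  assumes zero: "\<And>t. F t 0 = 0"
    and lipschitz: "\<And>t y z. norm (F t y - F t z) \<le> M * norm (y - z)"
    and measurable: "\<And>y. continuous_on UNIV y \<Longrightarrow> (\<lambda>t. F t (y t)) \<in> borel_measurable borel"
  shows "\<exists>y. continuous_on UNIV y \<and> (\<forall>x. y x = y0 + primitive x0 (\<lambda>t. F t (y t)) x)"
proof -
  define K where "K = \<bar>M\<bar> + 1"
  have "K > 0" by (simp add: K_def)
  have lipschitz': "norm (F t y - F t z) \<le> K * norm (y - z)" for t y z
    by (rule order_trans[OF lipschitz]) (simp add: K_def mult_right_mono)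
  have growth: "norm (F t y) \<le> K * norm y" for t y
    using lipschitz'[of t y 0] by (simp add: zero)
  have integrable: "(\<lambda>t. F t (y t)) integrable_on {a..b}" if "continuous_on UNIV y" for y a b
    by (rule borel_measurable_imp_integrable_Icc[where g = "\<lambda>t. K * norm (y t)"])
      (use that growth in \<open>auto intro!: measurable continuous_intros\<close>)
  \<comment> \<open>Any rate above the Lipschitz constant would do. This one makes the contraction factor \<open>1/2\<close>.\<close>
  define L where "L = 2 * K"
  have "L > 0" using \<open>K > 0\<close> by (simp add: L_def)
  define W where "W x = exp (L * \<bar>x - x0\<bar>)" for x
  have W_pos: "W x > 0" and W_ge_1: "W x \<ge> 1" and W_nz: "W x \<noteq> 0" for x
    using \<open>L > 0\<close> by (auto simp: W_def)
  have W_cont: "continuous_on S W" for S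
    unfolding W_def by (intro continuous_intros)
  define G where "G w x = F x (W x *\<^sub>R apply_bcontfun w x)" for w :: "real \<Rightarrow>\<^sub>C 'a" and x
  define \<Phi> where "\<Phi> w x = (1 / W x) *\<^sub>R (y0 + primitive x0 (G w) x)" for w x
  have weighted_cont: "continuous_on UNIV (\<lambda>x. W x *\<^sub>R apply_bcontfun w x)" for w :: "real \<Rightarrow>\<^sub>C 'a"
    by (intro continuous_on_scaleR W_cont continuous_on_apply_bcontfun)
  have G_int: "G w integrable_on {a..b}" for w a b
    unfolding G_def by (rule integrable[OF weighted_cont])
  have G_diff: "norm (G v t - G w t) \<le> (K * dist v w) * W t" for v w t
  proof -
    have "norm (G v t - G w t) \<le> K * (W t * norm (apply_bcontfun v t - apply_bcontfun w t))"
      unfolding G_def using lipschitz'[of t "W t *\<^sub>R apply_bcontfun v t" "W t *\<^sub>R apply_bcontfun w t"] W_pos[of t]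
      by (simp flip: scaleR_diff_right)
    also have "\<dots> \<le> K * (W t * dist v w)"
      using \<open>K > 0\<close> W_pos[of t] dist_bounded[of v t w] by (simp add: dist_norm)
    finally show ?thesis by (simp add: mult_ac)
  qed
  have G_bound: "norm (G w t) \<le> (K * norm w) * W t" for w t
    using G_diff[of w t 0] by (simp add: G_def zero)
  have \<Phi>_bcontfun: "\<Phi> w \<in> bcontfun" for w
  proof (rule bcontfun_normI)
    show "continuous_on UNIV (\<Phi> w)"
      unfolding \<Phi>_def
      by (intro continuous_intros W_cont continuous_on_primitive G_int) (simp add: W_nz)
    fix x
    have "norm (y0 + primitive x0 (G w) x) \<le> norm y0 + K * norm w / L * W x"
      using norm_primitive_le_exp[OF G_int \<open>L > 0\<close> G_bound[unfolded W_def], where x = x]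
      by (intro order_trans[OF norm_triangle_ineq]) (simp add: W_def)
    also have "\<dots> \<le> W x * (norm y0 + K * norm w / L)"
      using W_ge_1[of x] mult_right_mono[OF W_ge_1[of x] norm_ge_zero[of y0]] by (simp add: algebra_simps)
    finally show "norm (\<Phi> w x) \<le> norm y0 + K * norm w / L"
      using W_pos[of x] by (simp add: \<Phi>_def divide_simps mult.commute)
  qed
  have "dist (Bcontfun (\<Phi> v)) (Bcontfun (\<Phi> w)) \<le> 1/2 * dist v w" for v w
  proof (rule dist_bound)
    fix x
    have "primitive x0 (G v) x - primitive x0 (G w) x = primitive x0 (\<lambda>t. G v t - G w t) x"
      by (simp add: primitive_def Henstock_Kurzweil_Integration.integral_diff G_int)
    then have "norm (primitive x0 (G v) x - primitive x0 (G w) x) \<le> K * dist v w / L * W x"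
      using norm_primitive_le_exp[OF integrable_diff[OF G_int[of v] G_int[of w]] \<open>L > 0\<close> G_diff[unfolded W_def], where x = x]
      by (simp add: W_def)
    also have "K * dist v w / L = 1/2 * dist v w"
      using \<open>K > 0\<close> by (simp add: L_def)
    finally have "norm (primitive x0 (G v) x - primitive x0 (G w) x) \<le> 1/2 * dist v w * W x" .
    moreover have "dist (\<Phi> v x) (\<Phi> w x) = norm (primitive x0 (G v) x - primitive x0 (G w) x) / W x"
      using W_pos[of x] by (simp add: \<Phi>_def dist_norm flip: scaleR_diff_right)
    ultimately show "dist (apply_bcontfun (Bcontfun (\<Phi> v)) x) (apply_bcontfun (Bcontfun (\<Phi> w)) x) \<le> 1/2 * dist v w"
      using W_pos[of x] by (simp add: Bcontfun_inverse \<Phi>_bcontfun pos_divide_le_eq)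
  qed
  then obtain w where "Bcontfun (\<Phi> w) = w"
    using banach_fix_type[of "1/2" "\<lambda>w. Bcontfun (\<Phi> w)"] by auto
  then have fixed: "apply_bcontfun w x = \<Phi> w x" for x
    by (metis Bcontfun_inverse \<Phi>_bcontfun)
  have "W x *\<^sub>R apply_bcontfun w x = y0 + primitive x0 (G w) x" for x
    using W_pos[of x] by (subst fixed) (simp add: \<Phi>_def)
  then show ?thesis
    using weighted_cont[of w] unfolding G_def
    by (intro exI[of _ "\<lambda>x. W x *\<^sub>R apply_bcontfun w x"] conjI allI)
qed

text \<open>
  The wave equation is the first-order system \<open>(u, v)' = (v, - \<omega>\<^sup>2 / c\<^sup>2 u)\<close>. The integrated equation can
  be differentiated wherever the integrand is continuous, which is everywhere for the first component and
  at the continuity points of \<open>c\<close> for the second.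
\<close>
lemma wave_solution_exists:
  fixes c :: "real \<Rightarrow> real"
  assumes measurable: "c \<in> borel_measurable borel" and "m > 0" and bound: "\<And>x. m \<le> c x"
  shows "\<exists>u. wave_solution c \<omega> u \<and> u x0 = p \<and> deriv1 u x0 = (q::real)"
proof -
  define k where "k x = \<omega>\<^sup>2 / (c x)\<^sup>2" for x
  have k_nonneg: "0 \<le> k x" for x
    by (simp add: k_def)
  have k_le: "k x \<le> \<omega>\<^sup>2 / m\<^sup>2" for x
    unfolding k_def using \<open>m > 0\<close> bound[of x] by (intro divide_left_mono power_mono) auto
  define F :: "real \<Rightarrow> real \<times> real \<Rightarrow> real \<times> real" where "F t y = (snd y, - k t * fst y)" for t y
  have F_lipschitz: "norm (F t y - F t z) \<le> (1 + \<omega>\<^sup>2 / m\<^sup>2) * norm (y - z)" for t y z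
  proof -
    have "norm (F t y - F t z) \<le> \<bar>snd (y - z)\<bar> + k t * \<bar>fst (y - z)\<bar>"
    proof -
      have "F t y - F t z = (snd (y - z), - k t * fst (y - z))"
        by (simp add: F_def algebra_simps)
      then show ?thesis
        using norm_Pair_le[of "snd (y - z)" "- k t * fst (y - z)"] k_nonneg[of t]
        by (simp add: abs_mult)
    qed
    also have "\<dots> \<le> norm (y - z) + \<omega>\<^sup>2 / m\<^sup>2 * norm (y - z)"
      using norm_snd_le[of "snd (y - z)" "fst (y - z)"] norm_fst_le[of "fst (y - z)" "snd (y - z)"] k_le[of t] k_nonneg[of t]
      by (intro add_mono mult_mono) (auto simp: minus_prod_def)
    finally show ?thesis by (simp add: algebra_simps)
  qed
  have F_zero: "F t 0 = 0" for t
    by (simp add: F_def zero_prod_def)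
  have k_measurable: "k \<in> borel_measurable borel"
    unfolding k_def using measurable by measurable
  have F_measurable: "(\<lambda>t. F t (y t)) \<in> borel_measurable borel" if "continuous_on UNIV y" for y
  proof -
    have [measurable]: "y \<in> borel_measurable borel"
      by (rule borel_measurable_continuous_onI[OF that])
    have [measurable]: "fst \<in> borel_measurable (borel :: (real \<times> real) measure)" "snd \<in> borel_measurable (borel :: (real \<times> real) measure)"
      by (intro borel_measurable_continuous_onI continuous_intros)+
    show ?thesis
      unfolding F_def using k_measurable by measurable
  qed
  obtain y where y_cont: "continuous_on UNIV y"
    and y: "\<And>x. y x = (p, q) + primitive x0 (\<lambda>t. F t (y t)) x"
    using linear_volterra_solution_exists[of F, OF F_zero F_lipschitz F_measurable] by metis
  have y_isCont: "isCont y x" for x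
    using y_cont by (simp add: continuous_on_eq_continuous_at)
  have fst_integrable: "(\<lambda>t. snd (y t)) integrable_on {a..b}" for a b
    by (intro integrable_continuous_interval continuous_on_subset[OF continuous_on_snd[OF y_cont]]) auto
  have integrable: "(\<lambda>t. F t (y t)) integrable_on {a..b}" for a b
  proof (rule borel_measurable_imp_integrable_Icc[OF F_measurable[OF y_cont]])
    show "continuous_on UNIV (\<lambda>t. (1 + \<omega>\<^sup>2 / m\<^sup>2) * norm (y t))"
      by (intro continuous_intros y_cont)
    show "norm (F t (y t)) \<le> (1 + \<omega>\<^sup>2 / m\<^sup>2) * norm (y t)" for t
      using F_lipschitz[of t "y t" 0] by (simp add: F_zero)
  qed
  have snd_integrable: "(\<lambda>t. - k t * fst (y t)) integrable_on {a..b}" for a b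
    using integrable_linear[OF integrable bounded_linear_snd] by (simp add: F_def comp_def)
  have components: "integral {a..b} (\<lambda>t. F t (y t)) = (integral {a..b} (\<lambda>t. snd (y t)), integral {a..b} (\<lambda>t. - k t * fst (y t)))" for a b
    using integral_linear[OF integrable bounded_linear_fst, of a b] integral_linear[OF integrable bounded_linear_snd, of a b]
    by (simp add: prod_eq_iff F_def comp_def)
  define u v where "u x = fst (y x)" and "v x = snd (y x)" for x
  have u_eq: "u = (\<lambda>x. p + primitive x0 v x)" and v_eq: "v = (\<lambda>x. q + primitive x0 (\<lambda>t. - k t * u t) x)"
    unfolding u_def v_def by (rule ext, subst y, simp add: primitive_def components)+
  have u_deriv: "(u has_vector_derivative v x) (at x)" for x
  proof -
    have "(primitive x0 v has_vector_derivative v x) (at x)"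
      unfolding v_def
      by (intro primitive_has_vector_derivative fst_integrable isCont_snd y_isCont)
    then show ?thesis
      by (subst u_eq) (auto intro!: derivative_eq_intros)
  qed
  have deriv1_u: "deriv1 u x = v x" for x
    using u_deriv by (rule vector_derivative_at)
  have v_deriv: "(v has_vector_derivative - (\<omega>\<^sup>2 / (c x)\<^sup>2) *\<^sub>R u x) (at x)" if "isCont c x" for x
  proof -
    have "c x \<noteq> 0"
      using bound[of x] \<open>m > 0\<close> by auto
    have "(primitive x0 (\<lambda>t. - k t * u t) has_vector_derivative - k x * u x) (at x)"
    proof (rule primitive_has_vector_derivative)
      show "(\<lambda>t. - k t * u t) integrable_on {a..b}" for a b
        using snd_integrable by (simp add: u_def)
      show "isCont (\<lambda>t. - k t * u t) x"
        unfolding k_def u_def using \<open>c x \<noteq> 0\<close> by (intro continuous_intros that isCont_fst y_isCont) auto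
    qed
    then show ?thesis
      by (subst v_eq) (auto intro!: derivative_eq_intros simp: k_def)
  qed
  have "u C1_differentiable_on UNIV"
    unfolding C1_differentiable_on_def using u_deriv continuous_on_snd[OF y_cont, folded v_def] by blast
  moreover have "u x0 = p" "v x0 = q"
    unfolding u_def v_def by (subst y, simp)+
  ultimately show ?thesis
    using v_deriv unfolding wave_solution_def deriv1_u by (intro exI[of _ u]) (simp add: deriv1_u)
qed

section \<open>Symmetries of the interface medium\<close>

lemma wave_solution_derivatives:
  assumes "wave_solution c \<omega> u"
  shows wave_solution_has_vector_derivative: "(u has_vector_derivative deriv1 u x) (at x)"
    and wave_solution_continuous_deriv1: "continuous_on UNIV (deriv1 u)"
  using assms unfolding wave_solution_def C1_differentiable_on_eq
  by (auto simp: vector_derivative_works)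

text \<open>
  Reflection turns \<open>f\<close> into another solution wherever the medium is symmetric about \<open>m / 2\<close>, and the pairing
  is the Wronskian of that solution and \<open>g\<close>. Finitely many exceptional points are harmless because the
  Wronskian is continuous.
\<close>
lemma reflection_pairing:
  fixes f g :: "real \<Rightarrow> real"
  assumes f: "wave_solution c \<omega> f" and g: "wave_solution c \<omega> g"
    and "finite S" and "a \<le> b"
    and symmetric: "\<And>x. x \<in> {a<..<b} - S \<Longrightarrow> isCont c x \<and> isCont c (m - x) \<and> c (m - x) = c x"
  shows "f (m - b) * deriv1 g b + deriv1 f (m - b) * g b =
         f (m - a) * deriv1 g a + deriv1 f (m - a) * g a"
proof -
  let ?W = "\<lambda>x. f (m - x) * deriv1 g x + deriv1 f (m - x) * g x"
  have "((\<lambda>x. 0) has_integral ?W b - ?W a) {a..b}"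
  proof (rule fundamental_theorem_of_calculus_interior_strong[OF \<open>finite S\<close> \<open>a \<le> b\<close>])
    fix x assume x: "x \<in> {a<..<b} - S"
    have reflect: "((\<lambda>x. h (m - x)) has_real_derivative - h') (at x)"
      if "(h has_vector_derivative h') (at (m - x))" for h h'
    proof -
      have "((\<lambda>x. h (m - x)) has_real_derivative h' * - 1) (at x)"
        using that by (intro DERIV_chain2[of h])
          (auto intro!: derivative_eq_intros simp: has_real_derivative_iff_has_vector_derivative)
      then show ?thesis by simp
    qed
    have "(deriv1 f has_vector_derivative - (\<omega>\<^sup>2 / (c x)\<^sup>2) *\<^sub>R f (m - x)) (at (m - x))"
      using f symmetric[OF x] unfolding wave_solution_def by metis
    note f'' = reflect[OF this]
    have "(deriv1 g has_vector_derivative - (\<omega>\<^sup>2 / (c x)\<^sup>2) *\<^sub>R g x) (at x)"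
      using g symmetric[OF x] unfolding wave_solution_def by metis
    then have g'': "(deriv1 g has_real_derivative - (\<omega>\<^sup>2 / (c x)\<^sup>2) *\<^sub>R g x) (at x)"
      by (simp add: has_real_derivative_iff_has_vector_derivative)
    have g': "(g has_real_derivative deriv1 g x) (at x)"
      using wave_solution_has_vector_derivative[OF g]
      by (simp add: has_real_derivative_iff_has_vector_derivative)
    note f' = reflect[OF wave_solution_has_vector_derivative[OF f]]
    show "(?W has_vector_derivative 0) (at x)"
      unfolding has_real_derivative_iff_has_vector_derivative[symmetric]
      by (rule DERIV_cong[OF DERIV_add[OF DERIV_mult[OF f' g''] DERIV_mult[OF f'' g']]]) (simp add: algebra_simps)
  next
    have cont: "continuous_on UNIV f" "continuous_on UNIV g"
      using wave_solution_has_vector_derivative[OF f] wave_solution_has_vector_derivative[OF g]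
      by (auto intro!: continuous_at_imp_continuous_on has_vector_derivative_continuous)
    have "continuous_on {a..b} (\<lambda>x. h (m - x))" if "continuous_on UNIV h" for h :: "real \<Rightarrow> real"
      by (rule continuous_on_compose2[OF that]) (auto intro: continuous_intros)
    then show "continuous_on {a..b} ?W"
      using wave_solution_continuous_deriv1[OF f] wave_solution_continuous_deriv1[OF g] cont
      by (intro continuous_intros) (auto intro: continuous_on_subset)
  qed
  then have "?W b - ?W a = 0"
    using has_integral_0 has_integral_unique by blast
  then show ?thesis by simp
qed

lemma eventually_same_side:
  fixes x p q :: real
  assumes "x \<noteq> p" "x \<noteq> q"
  shows "\<forall>\<^sub>F y in nhds x. y \<in> {p..<q} \<longleftrightarrow> x \<in> {p..<q}"
proof -
  have "\<forall>\<^sub>F y in nhds x. y < t \<longleftrightarrow> x < t" if "x \<noteq> t" for t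
  proof (cases "x < t")
    case True
    then show ?thesis
      using eventually_nhds_in_open[of "{..<t}" x] by simp
  next
    case False
    then show ?thesis
      using eventually_nhds_in_open[of "{t<..}" x] that by (auto elim: eventually_mono)
  qed
  from this[OF assms(1)] this[OF assms(2)] show ?thesis
    by eventually_elim auto
qed

definition inclusion_ends :: "real \<Rightarrow> real \<Rightarrow> int \<Rightarrow> real set" where
  "inclusion_ends a s n =
     {of_int n + (1 - s - a) / 2, of_int n + (1 - s + a) / 2,
      of_int n + (1 + s - a) / 2, of_int n + (1 + s + a) / 2}"

lemma finite_inclusion_ends [simp]: "finite (inclusion_ends a s n)"
  by (simp add: inclusion_ends_def)

lemma eventually_inclusion_iff:
  assumes "x \<notin> inclusion_ends a s n"
  shows "\<forall>\<^sub>F y in nhds x. y \<in> inclusion a s n \<longleftrightarrow> x \<in> inclusion a s n"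
proof -
  have ends: "x \<noteq> of_int n + (1 - s - a) / 2" "x \<noteq> of_int n + (1 - s + a) / 2"
      "x \<noteq> of_int n + (1 + s - a) / 2" "x \<noteq> of_int n + (1 + s + a) / 2"
    using assms by (simp_all add: inclusion_ends_def)
  from eventually_same_side[OF ends(1,2)] eventually_same_side[OF ends(3,4)] show ?thesis
    unfolding inclusion_def Un_iff by eventually_elim simp
qed

lemma inclusion_in_cell:
  assumes "x \<in> inclusion a s n" and "0 < a" "a < s" "s < 1 - a"
  shows "of_int n < x" and "x < of_int n + 1"
  using assms by (auto simp: inclusion_def field_simps)

lemma isCont_locally_const:
  assumes "\<forall>\<^sub>F y in nhds x. c y = (k :: real)"
  shows "isCont c x"
  using isCont_cong[OF assms] by simp

text \<open>
  The two inequalities say that no inclusion reaches the boundary of its cell and that the two inclusions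
  of a cell do not overlap, on either side of the interface.
\<close>
context
  fixes r a \<epsilon> :: real
  assumes a: "0 < a" and left: "a < 1/2 - \<epsilon>" and right: "1/2 + \<epsilon> < 1 - a" and \<epsilon>: "0 < \<epsilon>"
begin

lemma interface_medium_left:
  assumes "-1 < x" "x < 0"
  shows "interface_medium r a (1/2) \<epsilon> x = (if x \<in> inclusion a (1/2 - \<epsilon>) (-1) then 1 / r else 1)"
proof -
  have "x \<notin> inclusion a (1/2 + \<epsilon>) n" if "n \<ge> 0" for n
    using inclusion_in_cell(1)[of x a "1/2 + \<epsilon>" n] that assms a \<epsilon> left right by fastforce
  moreover have "n = -1" if "x \<in> inclusion a (1/2 - \<epsilon>) n" for n
    using inclusion_in_cell[of x a "1/2 - \<epsilon>" n] that assms a \<epsilon> left right by linarith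
  ultimately show ?thesis
    unfolding interface_medium_def by (smt (verit))
qed

lemma interface_medium_right:
  assumes "0 < x" "x < 1"
  shows "interface_medium r a (1/2) \<epsilon> x = (if x \<in> inclusion a (1/2 + \<epsilon>) 0 then 1 / r else 1)"
proof -
  have "x \<notin> inclusion a (1/2 - \<epsilon>) n" if "n < 0" for n
    using inclusion_in_cell(2)[of x a "1/2 - \<epsilon>" n] that assms a \<epsilon> left right by force
  moreover have "n = 0" if "x \<in> inclusion a (1/2 + \<epsilon>) n" for n
    using inclusion_in_cell[of x a "1/2 + \<epsilon>" n] that assms a \<epsilon> left right by linarith
  ultimately show ?thesis
    unfolding interface_medium_def by (smt (verit))
qed

lemma isCont_interface_medium_left:
  assumes "-1 < x" "x < 0" "x \<notin> inclusion_ends a (1/2 - \<epsilon>) (-1)"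
  shows "isCont (interface_medium r a (1/2) \<epsilon>) x"
proof (rule isCont_locally_const)
  have "\<forall>\<^sub>F y in nhds x. y \<in> {-1<..<0}"
    by (rule eventually_nhds_in_open) (use assms in auto)
  with eventually_inclusion_iff[OF assms(3)]
  show "\<forall>\<^sub>F y in nhds x. interface_medium r a (1/2) \<epsilon> y = interface_medium r a (1/2) \<epsilon> x"
    by eventually_elim (use assms in \<open>simp add: interface_medium_left\<close>)
qed

lemma isCont_interface_medium_right:
  assumes "0 < x" "x < 1" "x \<notin> inclusion_ends a (1/2 + \<epsilon>) 0"
  shows "isCont (interface_medium r a (1/2) \<epsilon>) x"
proof (rule isCont_locally_const)
  have "\<forall>\<^sub>F y in nhds x. y \<in> {0<..<1}"
    by (rule eventually_nhds_in_open) (use assms in auto)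
  with eventually_inclusion_iff[OF assms(3)]
  show "\<forall>\<^sub>F y in nhds x. interface_medium r a (1/2) \<epsilon> y = interface_medium r a (1/2) \<epsilon> x"
    by eventually_elim (use assms in \<open>simp add: interface_medium_right\<close>)
qed

text \<open>
  The symmetries of the medium can fail at the ends of the inclusions, which are half-open, and continuity is
  needed both at a point and at its mirror image.
\<close>
definition "exceptional_points m =
  (let E = inclusion_ends a (1/2 - \<epsilon>) (-1) \<union> inclusion_ends a (1/2 + \<epsilon>) 0 in E \<union> (\<lambda>x. m - x) ` E)"

lemma finite_exceptional_points: "finite (exceptional_points m)"
  by (simp add: exceptional_points_def Let_def)

lemma not_exceptional:
  assumes "x \<notin> exceptional_points m"
  shows "x \<notin> inclusion_ends a (1/2 - \<epsilon>) (-1)" "x \<notin> inclusion_ends a (1/2 + \<epsilon>) 0"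
    "m - x \<notin> inclusion_ends a (1/2 - \<epsilon>) (-1)" "m - x \<notin> inclusion_ends a (1/2 + \<epsilon>) 0"
proof -
  have "x \<in> (\<lambda>x. m - x) ` E" if "m - x \<in> E" for E
    by (rule image_eqI[OF _ that]) simp
  with assms show "x \<notin> inclusion_ends a (1/2 - \<epsilon>) (-1)" "x \<notin> inclusion_ends a (1/2 + \<epsilon>) 0"
    "m - x \<notin> inclusion_ends a (1/2 - \<epsilon>) (-1)" "m - x \<notin> inclusion_ends a (1/2 + \<epsilon>) 0"
    unfolding exceptional_points_def Let_def by blast+
qed

lemma left_cell_symmetric:
  assumes "x \<in> {-1<..<-1/2} - exceptional_points (-1)"
  shows "isCont (interface_medium r a (1/2) \<epsilon>) x \<and> isCont (interface_medium r a (1/2) \<epsilon>) (-1 - x) \<and>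
    interface_medium r a (1/2) \<epsilon> (-1 - x) = interface_medium r a (1/2) \<epsilon> x"
proof -
  have x: "-1 < x" "x < -1/2" and ends: "x \<notin> inclusion_ends a (1/2 - \<epsilon>) (-1)" "-1 - x \<notin> inclusion_ends a (1/2 - \<epsilon>) (-1)"
    using assms not_exceptional[of x "-1"] by auto
  moreover have "-1 - x \<in> inclusion a (1/2 - \<epsilon>) (-1) \<longleftrightarrow> x \<in> inclusion a (1/2 - \<epsilon>) (-1)"
    using ends by (auto simp: inclusion_def inclusion_ends_def field_simps)
  ultimately show ?thesis
    by (simp add: isCont_interface_medium_left interface_medium_left)
qed

lemma right_cell_symmetric:
  assumes "x \<in> {0<..<1/2} - exceptional_points 1"
  shows "isCont (interface_medium r a (1/2) \<epsilon>) x \<and> isCont (interface_medium r a (1/2) \<epsilon>) (1 - x) \<and>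
    interface_medium r a (1/2) \<epsilon> (1 - x) = interface_medium r a (1/2) \<epsilon> x"
proof -
  have x: "0 < x" "x < 1/2" and ends: "x \<notin> inclusion_ends a (1/2 + \<epsilon>) 0" "1 - x \<notin> inclusion_ends a (1/2 + \<epsilon>) 0"
    using assms not_exceptional[of x 1] by auto
  moreover have "1 - x \<in> inclusion a (1/2 + \<epsilon>) 0 \<longleftrightarrow> x \<in> inclusion a (1/2 + \<epsilon>) 0"
    using ends by (auto simp: inclusion_def inclusion_ends_def field_simps)
  ultimately show ?thesis
    by (simp add: isCont_interface_medium_right interface_medium_right)
qed

text \<open>
  The periodic medium on the right is the one on the left shifted by half a period, so the first half of
  the right cell is the second half of the left cell.
  By mirror symmetry of the left cell this is the reversed first half.
\<close>
lemma half_cells_symmetric: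
  assumes "x \<in> {0<..<1/2} - exceptional_points (-1/2)"
  shows "isCont (interface_medium r a (1/2) \<epsilon>) x \<and> isCont (interface_medium r a (1/2) \<epsilon>) (-1/2 - x) \<and>
    interface_medium r a (1/2) \<epsilon> (-1/2 - x) = interface_medium r a (1/2) \<epsilon> x"
proof -
  have x: "0 < x" "x < 1/2" and ends: "x \<notin> inclusion_ends a (1/2 + \<epsilon>) 0" "-1/2 - x \<notin> inclusion_ends a (1/2 - \<epsilon>) (-1)"
    using assms not_exceptional[of x "-1/2"] by auto
  moreover have "-1/2 - x \<in> inclusion a (1/2 - \<epsilon>) (-1) \<longleftrightarrow> x \<in> inclusion a (1/2 + \<epsilon>) 0"
    using ends x a left right \<epsilon> by (auto simp: inclusion_def inclusion_ends_def field_simps)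
  ultimately show ?thesis
    by (simp add: isCont_interface_medium_left interface_medium_left isCont_interface_medium_right interface_medium_right)
qed

text \<open>
  Pairing the two fundamental solutions of a cell with each other by reflection about its midpoint
  expresses both diagonal entries by the same combination \<open>\<phi> \<psi>' + \<phi>' \<psi>\<close> of midpoint values. Pairing the
  fundamental solutions of the left cell with those of the right cell, by the symmetry of the half cells,
  shows that the midpoint values of the two cells agree up to a permutation which does not affect that
  combination.
\<close>
lemma transfer_matrices_equal_diagonals:
  assumes "r > 0"
    and TA: "left_transfer_matrix (interface_medium r a (1/2) \<epsilon>) \<omega> TA"
    and TB: "right_transfer_matrix (interface_medium r a (1/2) \<epsilon>) \<omega> TB"
  shows "TA $ 2 $ 2 = TA $ 1 $ 1" and "TB $ 1 $ 1 = TA $ 1 $ 1" and "TB $ 2 $ 2 = TA $ 1 $ 1"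
proof -
  let ?c = "interface_medium r a (1/2) \<epsilon>"
  have inclusion_measurable [measurable]: "inclusion a s n \<in> sets borel" for s n
    unfolding inclusion_def by simp
  have "?c \<in> borel_measurable borel"
    unfolding interface_medium_def by measurable
  moreover have "min 1 (1 / r) > 0" and "min 1 (1 / r) \<le> ?c x" for x
    using \<open>r > 0\<close> by (auto simp: interface_medium_def)
  ultimately have exists: "\<exists>u. wave_solution ?c \<omega> u \<and> u x0 = p \<and> deriv1 u x0 = q" for x0 p q :: real
    by (rule wave_solution_exists)
  obtain \<phi> :: "real \<Rightarrow> real" where \<phi>: "wave_solution ?c \<omega> \<phi>" "\<phi> (-1) = 1" "deriv1 \<phi> (-1) = 0" using exists[of "-1" 1 0] by auto
  obtain \<psi> :: "real \<Rightarrow> real" where \<psi>: "wave_solution ?c \<omega> \<psi>" "\<psi> (-1) = 0" "deriv1 \<psi> (-1) = 1" using exists[of "-1" 0 1] by auto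
  obtain f :: "real \<Rightarrow> real" where f: "wave_solution ?c \<omega> f" "f 0 = 1" "deriv1 f 0 = 0" using exists[of 0 1 0] by auto
  obtain g :: "real \<Rightarrow> real" where g: "wave_solution ?c \<omega> g" "g 0 = 0" "deriv1 g 0 = 1" using exists[of 0 0 1] by auto
  have A: "u 0 = TA $ 1 $ 1 * u (-1) + TA $ 1 $ 2 * deriv1 u (-1)"
      "deriv1 u 0 = TA $ 2 $ 1 * u (-1) + TA $ 2 $ 2 * deriv1 u (-1)" if "wave_solution ?c \<omega> u" for u
    using TA[unfolded left_transfer_matrix_def, rule_format, OF that, of "-1"]
    by (simp_all add: cell_state_def vec_eq_iff matrix_vector_mult_def sum_2 forall_2)
  have B: "u 1 = TB $ 1 $ 1 * u 0 + TB $ 1 $ 2 * deriv1 u 0"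
      "deriv1 u 1 = TB $ 2 $ 1 * u 0 + TB $ 2 $ 2 * deriv1 u 0" if "wave_solution ?c \<omega> u" for u
    using TB[unfolded right_transfer_matrix_def, rule_format, OF that, of 0]
    by (simp_all add: cell_state_def vec_eq_iff matrix_vector_mult_def sum_2 forall_2)
  have left_pairing: "u (-1/2) * deriv1 v (-1/2) + deriv1 u (-1/2) * v (-1/2) = u 0 * deriv1 v (-1) + deriv1 u 0 * v (-1)"
    if "wave_solution ?c \<omega> u" "wave_solution ?c \<omega> v" for u v :: "real \<Rightarrow> real"
    using reflection_pairing[OF that finite_exceptional_points _ left_cell_symmetric, of "-1" "-1/2" "-1"] by simp
  have right_pairing: "u (1/2) * deriv1 v (1/2) + deriv1 u (1/2) * v (1/2) = u 1 * deriv1 v 0 + deriv1 u 1 * v 0"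
    if "wave_solution ?c \<omega> u" "wave_solution ?c \<omega> v" for u v :: "real \<Rightarrow> real"
    using reflection_pairing[OF that finite_exceptional_points _ right_cell_symmetric, of 0 "1/2" 1] by simp
  have half_pairing: "u (-1) * deriv1 v (1/2) + deriv1 u (-1) * v (1/2) = u (-1/2) * deriv1 v 0 + deriv1 u (-1/2) * v 0"
    if "wave_solution ?c \<omega> u" "wave_solution ?c \<omega> v" for u v :: "real \<Rightarrow> real"
    using reflection_pairing[OF that finite_exceptional_points _ half_cells_symmetric, of 0 "1/2" "-1/2"] by simp
  \<comment> \<open>\<open>\<phi>\<close> and \<open>\<psi>\<close> are the fundamental solutions of the left cell, \<open>f\<close> and \<open>g\<close> those of the right cell.\<close>
  have "TA $ 1 $ 1 = \<phi> (-1/2) * deriv1 \<psi> (-1/2) + deriv1 \<phi> (-1/2) * \<psi> (-1/2)"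
    using left_pairing[OF \<phi>(1) \<psi>(1)] A(1)[OF \<phi>(1)] \<phi> \<psi> by simp
  moreover have "TA $ 2 $ 2 = \<psi> (-1/2) * deriv1 \<phi> (-1/2) + deriv1 \<psi> (-1/2) * \<phi> (-1/2)"
    using left_pairing[OF \<psi>(1) \<phi>(1)] A(2)[OF \<psi>(1)] \<phi> \<psi> by simp
  moreover have "TB $ 1 $ 1 = f (1/2) * deriv1 g (1/2) + deriv1 f (1/2) * g (1/2)"
    using right_pairing[OF f(1) g(1)] B(1)[OF f(1)] f g by simp
  moreover have "TB $ 2 $ 2 = g (1/2) * deriv1 f (1/2) + deriv1 g (1/2) * f (1/2)"
    using right_pairing[OF g(1) f(1)] B(2)[OF g(1)] f g by simp
  moreover have "deriv1 f (1/2) = deriv1 \<phi> (-1/2)"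
    using half_pairing[OF \<phi>(1) f(1)] \<phi> f by simp
  moreover have "deriv1 g (1/2) = \<phi> (-1/2)"
    using half_pairing[OF \<phi>(1) g(1)] \<phi> g by simp
  moreover have "f (1/2) = deriv1 \<psi> (-1/2)"
    using half_pairing[OF \<psi>(1) f(1)] \<psi> f by simp
  moreover have "g (1/2) = \<psi> (-1/2)"
    using half_pairing[OF \<psi>(1) g(1)] \<psi> g by simp
  ultimately show "TA $ 2 $ 2 = TA $ 1 $ 1" and "TB $ 1 $ 1 = TA $ 1 $ 1" and "TB $ 2 $ 2 = TA $ 1 $ 1"
    by (simp_all add: algebra_simps)
qed

end

section \<open>The homogenised equations order by order\<close>

lemma power_expansion_bounded_linear:
  assumes g: "bounded_linear g" and f: "power_expansion f c"
  shows "power_expansion (\<lambda>\<epsilon>. g (f \<epsilon>)) (\<lambda>k. g (c k))"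
  unfolding power_expansion_def
proof
  fix N
  interpret bounded_linear g by (rule g)
  obtain K where K: "\<And>x. norm (g x) \<le> norm x * K"
    using bounded by blast
  have "(\<lambda>\<epsilon>. norm (g (f \<epsilon>) - (\<Sum>k<N. \<epsilon> ^ k *\<^sub>R g (c k)))) \<in>
      O[at_right 0](\<lambda>\<epsilon>. norm (f \<epsilon> - (\<Sum>k<N. \<epsilon> ^ k *\<^sub>R c k)))"
  proof (intro bigoI[where c = K] always_eventually allI)
    fix \<epsilon> :: real
    have "g (f \<epsilon>) - (\<Sum>k<N. \<epsilon> ^ k *\<^sub>R g (c k)) = g (f \<epsilon> - (\<Sum>k<N. \<epsilon> ^ k *\<^sub>R c k))"
      by (simp add: diff sum scaleR)
    then show "norm (norm (g (f \<epsilon>) - (\<Sum>k<N. \<epsilon> ^ k *\<^sub>R g (c k)))) \<le> K * norm (norm (f \<epsilon> - (\<Sum>k<N. \<epsilon> ^ k *\<^sub>R c k)))"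
      using K by (simp add: mult.commute)
  qed
  also have "(\<lambda>\<epsilon>. norm (f \<epsilon> - (\<Sum>k<N. \<epsilon> ^ k *\<^sub>R c k))) \<in> O[at_right 0](\<lambda>\<epsilon>. \<epsilon> ^ N)"
    using f by (simp add: power_expansion_def)
  finally show "(\<lambda>\<epsilon>. norm (g (f \<epsilon>) - (\<Sum>k<N. \<epsilon> ^ k *\<^sub>R g (c k)))) \<in> O[at_right 0](\<lambda>\<epsilon>. \<epsilon> ^ N)" .
qed

text \<open>
  The first coefficient that does not vanish would dominate all later terms.
\<close>
lemma power_expansion_of_zero:
  assumes f: "power_expansion f c" and zero: "\<forall>\<^sub>F \<epsilon> in at_right 0. f \<epsilon> = 0"
  shows "c k = 0"
proof (induction k rule: less_induct)
  case (less k)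
  obtain C where "\<forall>\<^sub>F \<epsilon> in at_right 0. norm (norm (f \<epsilon> - (\<Sum>j<Suc k. \<epsilon> ^ j *\<^sub>R c j))) \<le> C * norm (\<epsilon> ^ Suc k)"
    using f unfolding power_expansion_def by (elim allE[of _ "Suc k"] landau_o.bigE) blast
  with zero eventually_at_right_less[of "0 :: real"]
  have "\<forall>\<^sub>F \<epsilon> in at_right 0. norm (c k) \<le> C * \<epsilon>"
  proof eventually_elim
    case (elim \<epsilon>)
    have "(\<Sum>j<k. \<epsilon> ^ j *\<^sub>R c j) = 0"
      using less by simp
    then have "\<epsilon> ^ k * norm (c k) \<le> \<epsilon> ^ k * (C * \<epsilon>)"
      using elim by (simp add: power_abs abs_mult mult_ac)
    then show ?case
      using elim by simp
  qed
  moreover have "((\<lambda>\<epsilon>. C * \<epsilon>) \<longlongrightarrow> C * 0) (at_right 0)"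
    by (intro tendsto_intros)
  ultimately have "norm (c k) \<le> C * 0"
    using tendsto_lowerbound[of _ _ "at_right (0::real)"] by fastforce
  then show ?case by simp
qed

lemma power_expansion_leading_error:
  assumes "power_expansion f c"
  shows "\<exists>C. \<forall>\<^sub>F \<epsilon> in at_right 0. norm (f \<epsilon> - c 0) \<le> C * \<epsilon>"
proof -
  obtain C where "\<forall>\<^sub>F \<epsilon> in at_right 0. norm (norm (f \<epsilon> - (\<Sum>k<1. \<epsilon> ^ k *\<^sub>R c k))) \<le> C * norm (\<epsilon> ^ 1)"
    using assms unfolding power_expansion_def by (elim allE[of _ 1] landau_o.bigE) blast
  with eventually_at_right_less[of "0 :: real"]
  have "\<forall>\<^sub>F \<epsilon> in at_right 0. norm (f \<epsilon> - c 0) \<le> C * \<epsilon>"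
    by eventually_elim simp
  then show ?thesis ..
qed

text \<open>
  Once the jump term is gone, both sides of the equations of order zero and one are continuous, and they
  can be compared at a point where \<open>w 0\<close> is nonzero.
\<close>
lemma order_equations_band_edge:
  assumes eqs: "order_equations i w u v T P"
    and w: "\<And>k. continuous_decaying (w k)" and nonzero: "w 0 \<eta> \<noteq> 0"
    and P: "P 0 $ i $ i = 0"
  shows "T 0 $ i $ i = -1" and "T 1 $ i $ i = 0"
proof -
  have cont: "continuous_on UNIV (w k)" for k
    using w by (simp add: continuous_decaying_def)
  have "- 2 * w 0 \<eta> = 2 * (T 0 $ i $ i) * w 0 \<eta>"
    by (rule regular_eq_imp_eq) (use eqs in \<open>auto simp: order_equations_def intro!: continuous_intros cont\<close>)
  then have "w 0 \<eta> * (T 0 $ i $ i + 1) = 0"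
    by (simp add: algebra_simps)
  then show T0: "T 0 $ i $ i = -1"
    using nonzero by (simp add: add_eq_0_iff2)
  have "- 2 * w 1 \<eta> = 2 * ((T 0 $ i $ i) * w 1 \<eta> + (T 1 $ i $ i) * w 0 \<eta>)"
    by (rule regular_eq_imp_eq) (use eqs in \<open>auto simp: order_equations_def P intro!: continuous_intros cont\<close>)
  then show "T 1 $ i $ i = 0"
    using nonzero T0 by simp
qed

text \<open>
  The equation of order two loses \<open>w 2\<close> because \<open>T 0 $ i $ i = -1\<close>, and \<open>w 1\<close> because \<open>T 1 $ i $ i = 0\<close>. What
  is left involves \<open>w 0\<close> only, apart from the strength of the point source.
\<close>
lemma order_equations_profile:
  assumes eqs: "order_equations i w u v T P"
    and w: "\<And>k. continuous_decaying (w k)"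
    and T: "T 0 $ i $ i = -1" "T 1 $ i $ i = 0" "- 2 * (T 2 $ i $ i) = l\<^sup>2" and "l > 0"
    and P: "P 0 $ i $ i = 0" "P 1 $ i $ i = 0"
  shows "w 0 \<eta> = ((P 0 $ i $ 1) * u 0 0 + (P 0 $ i $ 2) * v 0 0) / (2 * l) * exp (- l * \<bar>\<eta>\<bar>)"
proof (rule weak_solution_with_point_source[OF w \<open>l > 0\<close>])
  fix \<phi> assume \<phi>: "test_function \<phi>"
  have cont: "continuous_on UNIV (w k)" for k
    using w by (simp add: continuous_decaying_def)
  note int = integrable_mult_test_function[OF cont \<phi>]
  let ?\<kappa> = "(P 0 $ i $ 1) * u 0 0 + (P 0 $ i $ 2) * v 0 0"
  have "(LINT x|lborel. - 2 * w 2 x * \<phi> x) - (LINT x|lborel. w 0 x * deriv (deriv \<phi>) x) =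
      (LINT x|lborel. 2 * ((T 0 $ i $ i) * w 2 x + (T 1 $ i $ i) * w 1 x + (T 2 $ i $ i) * w 0 x) * \<phi> x) + ?\<kappa> * \<phi> 0"
    using eqs \<phi> unfolding order_equations_def eq_distribution_def
    by (simp add: P P(2)[unfolded One_nat_def] regular_def distribution_deriv_def distribution_minus_def distribution_add_def distribution_mult_def dirac_def)
  also have "(\<lambda>x. 2 * ((T 0 $ i $ i) * w 2 x + (T 1 $ i $ i) * w 1 x + (T 2 $ i $ i) * w 0 x) * \<phi> x) =
      (\<lambda>x. - 2 * (w 2 x * \<phi> x) - l\<^sup>2 * (w 0 x * \<phi> x))"
    by (simp add: T(1) T(2)[unfolded One_nat_def] fun_eq_iff algebra_simps flip: T(3))
  finally show "(LINT x|lborel. w 0 x * deriv (deriv \<phi>) x) = l\<^sup>2 * (LINT x|lborel. w 0 x * \<phi> x) - ?\<kappa> * \<phi> 0"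
    using int by (simp add: mult.assoc)
qed


section \<open>Decay rate and normalisation\<close>

text \<open>
  The derivative of \<open>exp (- m t)\<close> with respect to the rate is \<open>- t exp (- m t)\<close>, which is bounded uniformly in \<open>t\<close>
  as long as the rate stays away from zero.
\<close>
lemma exp_rate_perturbation:
  fixes l m t :: real
  assumes "l > 0" and "m \<ge> l / 2" and "t \<ge> 0"
  shows "\<bar>exp (- m * t) - exp (- l * t)\<bar> \<le> 2 / l * \<bar>m - l\<bar>"
proof -
  have le: "exp (- p * t) - exp (- q * t) \<le> 2 / l * (q - p)" if "l / 2 \<le> p" "p \<le> q" for p q
  proof -
    have "exp (- q * t) = exp (- p * t) * exp (- ((q - p) * t))"
      by (simp add: algebra_simps flip: exp_add)
    then have "exp (- p * t) - exp (- q * t) = exp (- p * t) * (1 - exp (- ((q - p) * t)))"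
      by (simp add: algebra_simps)
    also have "\<dots> \<le> exp (- (l / 2 * t)) * ((q - p) * t)"
      using exp_ge_add_one_self[of "- ((q - p) * t)"] that \<open>t \<ge> 0\<close> mult_right_mono[of "l / 2" p t]
      by (intro mult_mono) auto
    also have "\<dots> = (q - p) * (2 / l) * (exp (- (l / 2 * t)) * (l / 2 * t))"
      using \<open>l > 0\<close> by simp
    also have "\<dots> \<le> (q - p) * (2 / l) * 1"
    proof (rule mult_left_mono)
      have "l / 2 * t \<le> exp (l / 2 * t)"
        using exp_ge_add_one_self[of "l / 2 * t"] by linarith
      then show "exp (- (l / 2 * t)) * (l / 2 * t) \<le> 1"
        by (simp add: exp_minus field_simps)
    qed (use that \<open>l > 0\<close> in simp)
    finally show ?thesis by (simp add: mult.commute)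
  qed
  show ?thesis
  proof (cases "m \<le> l")
    case True
    then show ?thesis
      using le[of m l] assms mult_right_mono[OF True \<open>t \<ge> 0\<close>] by (simp add: abs_of_nonneg abs_of_nonpos)
  next
    case False
    then have "l \<le> m" by simp
    then show ?thesis
      using le[of l m] assms mult_right_mono[OF \<open>l \<le> m\<close> \<open>t \<ge> 0\<close>] by (simp add: abs_of_nonneg abs_of_nonpos)
  qed
qed

text \<open>
  The unnormalised profile has maximum \<open>K\<close> up to \<open>C \<epsilon>\<close>, so \<open>\<bar>\<alpha> \<epsilon>\<bar> K\<close> is close to one: the value at \<open>n = 0\<close> bounds
  \<open>\<bar>\<alpha> \<epsilon>\<bar>\<close> from above, and the mesh point where the normalised mode has modulus one bounds it from below.
\<close>
lemma normalised_profile: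
  assumes "K > 0"
    and approx: "\<forall>\<^sub>F \<epsilon> in at_right 0. \<forall>n::int. \<bar>\<bar>f \<epsilon> n\<bar> - K * exp (- l * (\<epsilon> * \<bar>real_of_int n\<bar>))\<bar> \<le> C * \<epsilon>" and "l > 0"
    and normalised: "\<forall>\<^sub>F \<epsilon> in at_right 0. (\<forall>n::int. \<bar>\<alpha> \<epsilon> * f \<epsilon> n\<bar> \<le> 1) \<and> (\<exists>n::int. \<bar>\<alpha> \<epsilon> * f \<epsilon> n\<bar> = 1)"
  shows "\<forall>\<^sub>F \<epsilon> in at_right 0. \<forall>n::int.
    \<bar>\<bar>\<alpha> \<epsilon> * f \<epsilon> n\<bar> - exp (- l * (\<epsilon> * \<bar>real_of_int n\<bar>))\<bar> \<le> 4 * C / K * \<epsilon>"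
proof -
  have "((\<lambda>\<epsilon>. C * \<epsilon>) \<longlongrightarrow> C * 0) (at_right 0)"
    by (intro tendsto_intros)
  then have "\<forall>\<^sub>F \<epsilon> in at_right 0. C * \<epsilon> < K / 2"
    by (rule order_tendstoD) (use \<open>K > 0\<close> in simp)
  with approx normalised eventually_at_right_less[of "0 :: real"] show ?thesis
  proof eventually_elim
    case (elim \<epsilon>)
    let ?e = "\<lambda>n::int. exp (- l * (\<epsilon> * \<bar>real_of_int n\<bar>))"
    have e_le: "?e n \<le> 1" for n
      using elim \<open>l > 0\<close> by simp
    define A where "A = \<bar>\<alpha> \<epsilon>\<bar>"
    have "A \<ge> 0" by (simp add: A_def)
    have C_nonneg: "0 \<le> C * \<epsilon>"
      using order_trans[OF abs_ge_zero elim(1)[rule_format, of 0]] .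
    have "A * (K - C * \<epsilon>) \<le> A * \<bar>f \<epsilon> 0\<bar>"
      using elim(1)[rule_format, of 0] \<open>A \<ge> 0\<close> by (intro mult_left_mono) auto
    also have "\<dots> \<le> 1"
      using elim by (simp add: A_def flip: abs_mult)
    finally have lower: "A * (K - C * \<epsilon>) \<le> 1" .
    obtain n where "1 = A * \<bar>f \<epsilon> n\<bar>"
      using elim by (auto simp: A_def abs_mult)
    also have "\<bar>f \<epsilon> n\<bar> \<le> K * ?e n + C * \<epsilon>"
      using elim(1)[rule_format, of n] by linarith
    also have "K * ?e n \<le> K"
      using e_le[of n] \<open>K > 0\<close> by simp
    finally have upper: "1 \<le> A * (K + C * \<epsilon>)"
      using \<open>A \<ge> 0\<close> by (simp add: mult_left_mono)
    have "A * (K / 2) \<le> A * (K - C * \<epsilon>)"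
      using elim \<open>A \<ge> 0\<close> by (intro mult_left_mono) auto
    then have A_le: "A \<le> 2 / K"
      using lower \<open>K > 0\<close> by (simp add: field_simps)
    have err: "A * (C * \<epsilon>) \<le> 2 / K * (C * \<epsilon>)"
      using A_le C_nonneg by (rule mult_right_mono)
    have AK: "\<bar>A * K - 1\<bar> \<le> A * (C * \<epsilon>)"
      using lower upper by (simp add: algebra_simps abs_le_iff)
    show ?case
    proof
      fix n :: int
      have "\<bar>\<alpha> \<epsilon> * f \<epsilon> n\<bar> - ?e n = A * (\<bar>f \<epsilon> n\<bar> - K * ?e n) + (A * K - 1) * ?e n"
        by (simp add: A_def abs_mult algebra_simps)
      also have "\<bar>\<dots>\<bar> \<le> A * \<bar>\<bar>f \<epsilon> n\<bar> - K * ?e n\<bar> + \<bar>A * K - 1\<bar> * ?e n"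
        using \<open>A \<ge> 0\<close> by (intro order_trans[OF abs_triangle_ineq]) (simp add: abs_mult)
      also have "\<dots> \<le> A * (C * \<epsilon>) + \<bar>A * K - 1\<bar> * 1"
        using elim(1) \<open>A \<ge> 0\<close> e_le by (intro add_mono mult_left_mono) auto
      also have "\<dots> \<le> 2 / K * (C * \<epsilon>) + 2 / K * (C * \<epsilon>)"
        using order_trans[OF AK err] err by (intro add_mono) simp_all
      finally show "\<bar>\<bar>\<alpha> \<epsilon> * f \<epsilon> n\<bar> - ?e n\<bar> \<le> 4 * C / K * \<epsilon>"
        by simp
    qed
  qed
qed

lemma sqrt_perturbation:
  fixes x y :: real
  assumes "x \<ge> 0" "y > 0"
  shows "\<bar>sqrt x - sqrt y\<bar> \<le> \<bar>x - y\<bar> / sqrt y"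
proof -
  have "x - y = (sqrt x - sqrt y) * (sqrt x + sqrt y)"
    using assms by (simp add: algebra_simps)
  then have "\<bar>x - y\<bar> = \<bar>sqrt x - sqrt y\<bar> * (sqrt x + sqrt y)"
    using assms by (simp add: abs_mult)
  then show ?thesis
    using assms mult_left_mono[of "sqrt y" "sqrt x + sqrt y" "\<bar>sqrt x - sqrt y\<bar>"]
    by (simp add: pos_le_divide_eq)
qed

text \<open>
  The square root is differentiable at the positive number \<open>(2 l)\<^sup>2\<close>, so it preserves first-order errors.
\<close>
lemma decay_rate_perturbation:
  fixes p q :: "real \<Rightarrow> real"
  assumes p: "\<forall>\<^sub>F \<epsilon> in at_right 0. \<bar>p \<epsilon> - p0\<bar> \<le> C1 * \<epsilon>"
    and q: "\<forall>\<^sub>F \<epsilon> in at_right 0. \<bar>q \<epsilon> - q0\<bar> \<le> C2 * \<epsilon>"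
    and "l > 0" and pq: "p0 * q0 = (2 * l)\<^sup>2"
  shows "\<exists>C. \<forall>\<^sub>F \<epsilon> in at_right 0. \<bar>sqrt (p \<epsilon> * q \<epsilon>) / 2 - l\<bar> \<le> C * \<epsilon>"
proof -
  define C where "C = \<bar>C1\<bar> * (\<bar>q0\<bar> + \<bar>C2\<bar>) + \<bar>p0\<bar> * \<bar>C2\<bar>"
  have "\<forall>\<^sub>F \<epsilon> in at_right 0. \<epsilon> < (1::real)"
    by (rule eventually_at_rightI[of 0 1]) auto
  with p q eventually_at_right_less[of "0 :: real"]
  have prod: "\<forall>\<^sub>F \<epsilon> in at_right 0. \<bar>p \<epsilon> * q \<epsilon> - (2 * l)\<^sup>2\<bar> \<le> C * \<epsilon>"
  proof eventually_elim
    case (elim \<epsilon>)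
    have p_err: "\<bar>p \<epsilon> - p0\<bar> \<le> \<bar>C1\<bar> * \<epsilon>" and q_err: "\<bar>q \<epsilon> - q0\<bar> \<le> \<bar>C2\<bar> * \<epsilon>"
      using elim mult_right_mono[OF abs_ge_self[of C1], of \<epsilon>] mult_right_mono[OF abs_ge_self[of C2], of \<epsilon>]
      by linarith+
    have "\<bar>C2\<bar> * \<epsilon> \<le> \<bar>C2\<bar>"
      using elim by (simp add: mult_left_le)
    then have "\<bar>q \<epsilon>\<bar> \<le> \<bar>q0\<bar> + \<bar>C2\<bar>"
      using q_err by linarith
    moreover have "p \<epsilon> * q \<epsilon> - (2 * l)\<^sup>2 = (p \<epsilon> - p0) * q \<epsilon> + p0 * (q \<epsilon> - q0)"
      unfolding pq[symmetric] by (simp add: algebra_simps)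
    then have "\<bar>p \<epsilon> * q \<epsilon> - (2 * l)\<^sup>2\<bar> \<le> \<bar>p \<epsilon> - p0\<bar> * \<bar>q \<epsilon>\<bar> + \<bar>p0\<bar> * \<bar>q \<epsilon> - q0\<bar>"
      by (metis abs_mult abs_triangle_ineq)
    moreover have "\<bar>p \<epsilon> - p0\<bar> * \<bar>q \<epsilon>\<bar> \<le> \<bar>C1\<bar> * \<epsilon> * (\<bar>q0\<bar> + \<bar>C2\<bar>)"
      using p_err calculation(1) elim by (intro mult_mono) auto
    moreover have "\<bar>p0\<bar> * \<bar>q \<epsilon> - q0\<bar> \<le> \<bar>p0\<bar> * (\<bar>C2\<bar> * \<epsilon>)"
      using q_err by (intro mult_left_mono) auto
    ultimately show ?case
      by (simp add: C_def algebra_simps)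
  qed
  have "((\<lambda>\<epsilon>. C * \<epsilon>) \<longlongrightarrow> C * 0) (at_right 0)"
    by (intro tendsto_intros)
  then have "\<forall>\<^sub>F \<epsilon> in at_right 0. C * \<epsilon> < (2 * l)\<^sup>2"
    by (rule order_tendstoD) (use \<open>l > 0\<close> in simp)
  with prod have "\<forall>\<^sub>F \<epsilon> in at_right 0. \<bar>sqrt (p \<epsilon> * q \<epsilon>) / 2 - l\<bar> \<le> C / (4 * l) * \<epsilon>"
  proof eventually_elim
    case (elim \<epsilon>)
    then have nonneg: "p \<epsilon> * q \<epsilon> \<ge> 0" by linarith
    have pos: "(2 * l)\<^sup>2 > 0" and sqrt: "sqrt ((2 * l)\<^sup>2) = 2 * l"
      using \<open>l > 0\<close> by (auto intro: real_sqrt_unique)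
    have "\<bar>sqrt (p \<epsilon> * q \<epsilon>) - 2 * l\<bar> \<le> \<bar>p \<epsilon> * q \<epsilon> - (2 * l)\<^sup>2\<bar> / (2 * l)"
      using sqrt_perturbation[OF nonneg pos] unfolding sqrt .
    also have "\<dots> \<le> C * \<epsilon> / (2 * l)"
      using elim \<open>l > 0\<close> by (intro divide_right_mono) auto
    finally show ?case
      using \<open>l > 0\<close> by (simp add: field_simps abs_le_iff)
  qed
  then show ?thesis ..
qed


section \<open>The decay of the localised mode\<close>

theorem theorem3p5:
  fixes r a :: real
    and TA TB :: "real \<Rightarrow> real \<Rightarrow> real^2^2"
    and \<omega> \<alpha> :: "real \<Rightarrow> real"
    and u :: "real \<Rightarrow> real \<Rightarrow> real"
  assumes "r > 0" and "r \<noteq> 1" and "0 < a" and "a < 1/2"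
    and transfer_matrices: "\<forall>\<^sub>F \<epsilon> in at_right 0. \<forall>\<omega>'.
           left_transfer_matrix (interface_medium r a (1/2) \<epsilon>) \<omega>' (TA \<epsilon> \<omega>') \<and>
           right_transfer_matrix (interface_medium r a (1/2) \<epsilon>) \<omega>' (TB \<epsilon> \<omega>')"
    and eigenmode: "\<forall>\<^sub>F \<epsilon> in at_right 0. localised_eigenmode r a (1/2) \<epsilon> (\<omega> \<epsilon>) (u \<epsilon>)"
    and ansatz: "homogenisation_ansatz r a (1/2) TA TB \<omega> u"
    and normalised: "\<forall>\<^sub>F \<epsilon> in at_right 0.
           (\<forall>n::int. \<bar>\<alpha> \<epsilon> * u \<epsilon> (of_int n)\<bar> \<le> 1) \<and>
           (\<exists>n::int. \<bar>\<alpha> \<epsilon> * u \<epsilon> (of_int n)\<bar> = 1)"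
  shows "\<exists>C. \<forall>\<^sub>F \<epsilon> in at_right 0. \<forall>n::int.
           \<bar> \<bar>\<alpha> \<epsilon> * u \<epsilon> (of_int n)\<bar>
             - exp (- (1/2) * sqrt ((TB \<epsilon> (\<omega> \<epsilon>) $ 1 $ 2 - TA \<epsilon> (\<omega> \<epsilon>) $ 1 $ 2) *
                                    (TB \<epsilon> (\<omega> \<epsilon>) $ 2 $ 1 - TA \<epsilon> (\<omega> \<epsilon>) $ 2 $ 1))
                    * \<bar>real_of_int n\<bar>) \<bar> \<le> C * \<epsilon>"
proof -
  obtain U V us vs T P \<eta>0 where
    alternation: "\<forall>\<^sub>F \<epsilon> in at_right 0. \<forall>n::int.
           u \<epsilon> (of_int n) = (-1) powi n * U \<epsilon> (\<epsilon> * of_int n) \<and>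
           deriv1 (u \<epsilon>) (of_int n) = (-1) powi n * V \<epsilon> (\<epsilon> * of_int n)"
    and U: "uniform_power_expansion U us"
    and all_decaying: "\<forall>k. continuous_decaying (us k) \<and> continuous_decaying (vs k)"
    and \<eta>0: "us 0 \<eta>0 \<noteq> 0"
    and T: "power_expansion (\<lambda>\<epsilon>. TA \<epsilon> (\<omega> \<epsilon>)) T"
    and P: "power_expansion (\<lambda>\<epsilon>. (1 / \<epsilon>) *\<^sub>R (TB \<epsilon> (\<omega> \<epsilon>) - TA \<epsilon> (\<omega> \<epsilon>))) P"
    and T2: "- 2 * (T 2 $ 1 $ 1) > 0"
    and u_eqs: "order_equations 1 us us vs T P" and v_eqs: "order_equations 2 vs us vs T P"
    using ansatz unfolding homogenisation_ansatz_def by (elim exE conjE) (rule that; assumption)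
  have decaying: "continuous_decaying (us k)" "continuous_decaying (vs k)" for k
    using all_decaying by auto
  define PE where "PE \<epsilon> = (1 / \<epsilon>) *\<^sub>R (TB \<epsilon> (\<omega> \<epsilon>) - TA \<epsilon> (\<omega> \<epsilon>))" for \<epsilon>
  have entry: "bounded_linear (\<lambda>M :: real^2^2. M $ i $ j)" for i j
    by (intro bounded_linear_compose[OF bounded_linear_vec_nth] bounded_linear_vec_nth)
  have "\<forall>\<^sub>F \<epsilon> in at_right 0. \<epsilon> < 1/2 - a"
    by (rule eventually_at_rightI[of 0 "1/2 - a"]) (use \<open>a < 1/2\<close> in auto)
  with transfer_matrices eventually_at_right_less[of "0 :: real"]
  have diagonals: "\<forall>\<^sub>F \<epsilon> in at_right 0.
      TA \<epsilon> (\<omega> \<epsilon>) $ 2 $ 2 = TA \<epsilon> (\<omega> \<epsilon>) $ 1 $ 1 \<and>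
      TB \<epsilon> (\<omega> \<epsilon>) $ 1 $ 1 = TA \<epsilon> (\<omega> \<epsilon>) $ 1 $ 1 \<and> TB \<epsilon> (\<omega> \<epsilon>) $ 2 $ 2 = TA \<epsilon> (\<omega> \<epsilon>) $ 1 $ 1"
  proof eventually_elim
    case (elim \<epsilon>)
    then have small: "a < 1/2 - \<epsilon>" "1/2 + \<epsilon> < 1 - a" by auto
    show ?case
      using transfer_matrices_equal_diagonals[OF \<open>0 < a\<close> small elim(2) \<open>r > 0\<close>] elim(1) by blast
  qed
  have T_diagonal: "T k $ 2 $ 2 = T k $ 1 $ 1" for k
  proof -
    have "\<forall>\<^sub>F \<epsilon> in at_right 0. TA \<epsilon> (\<omega> \<epsilon>) $ 2 $ 2 - TA \<epsilon> (\<omega> \<epsilon>) $ 1 $ 1 = 0"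
      using diagonals by eventually_elim simp
    from power_expansion_of_zero[OF power_expansion_bounded_linear[OF bounded_linear_sub[OF entry entry] T] this, of k]
    show ?thesis by simp
  qed
  \<comment> \<open>The jump terms of the homogenised equations vanish.\<close>
  have P_diagonal: "P k $ 1 $ 1 = 0" "P k $ 2 $ 2 = 0" for k
  proof -
    have "\<forall>\<^sub>F \<epsilon> in at_right 0. ((1 / \<epsilon>) *\<^sub>R (TB \<epsilon> (\<omega> \<epsilon>) - TA \<epsilon> (\<omega> \<epsilon>))) $ i $ i = 0" if "i = 1 \<or> i = 2" for i :: 2
      using diagonals by eventually_elim (use that in auto)
    from power_expansion_of_zero[OF power_expansion_bounded_linear[OF entry P] this]
    show "P k $ 1 $ 1 = 0" "P k $ 2 $ 2 = 0" by simp_all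
  qed
  define l where "l = sqrt (- 2 * (T 2 $ 1 $ 1))"
  have "l > 0" and l: "- 2 * (T 2 $ 1 $ 1) = l\<^sup>2"
    using T2 by (simp_all add: l_def)
  have T01: "T 0 $ 1 $ 1 = -1" "T 1 $ 1 $ 1 = 0"
    using order_equations_band_edge[OF u_eqs decaying(1) \<eta>0] P_diagonal by auto
  have us: "us 0 \<eta> = (P 0 $ 1 $ 2) * vs 0 0 / (2 * l) * exp (- l * \<bar>\<eta>\<bar>)" for \<eta>
    using order_equations_profile[OF u_eqs decaying(1) T01 l \<open>l > 0\<close>] P_diagonal by simp
  have vs: "vs 0 \<eta> = (P 0 $ 2 $ 1) * us 0 0 / (2 * l) * exp (- l * \<bar>\<eta>\<bar>)" for \<eta>
    using order_equations_profile[OF v_eqs decaying(2), of l] T01 l \<open>l > 0\<close> P_diagonal T_diagonal by simp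
  define K where "K = \<bar>us 0 0\<bar>"
  have us_K: "\<bar>us 0 \<eta>\<bar> = K * exp (- l * \<bar>\<eta>\<bar>)" for \<eta>
  proof -
    have "us 0 0 = (P 0 $ 1 $ 2) * vs 0 0 / (2 * l)"
      using us[of 0] by simp
    then have "us 0 \<eta> = us 0 0 * exp (- l * \<bar>\<eta>\<bar>)"
      by (subst us) simp
    then show ?thesis
      by (simp add: K_def abs_mult)
  qed
  have "K > 0"
    using us_K[of \<eta>0] \<eta>0 by (auto simp: K_def)
  then have "us 0 0 \<noteq> 0"
    by (simp add: K_def)
  \<comment> \<open>\<open>us 0 0\<close> and \<open>vs 0 0\<close> determine each other through their point sources, which fixes the product.\<close>
  have P_product: "(P 0 $ 1 $ 2) * (P 0 $ 2 $ 1) = (2 * l)\<^sup>2"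
  proof -
    have "us 0 0 * (2 * l) = P 0 $ 1 $ 2 * vs 0 0"
      by (subst us) (use \<open>l > 0\<close> in simp)
    moreover have "vs 0 0 * (2 * l) = P 0 $ 2 $ 1 * us 0 0"
      by (subst vs) (use \<open>l > 0\<close> in simp)
    ultimately have "us 0 0 * (2 * l)\<^sup>2 = (P 0 $ 1 $ 2) * (P 0 $ 2 $ 1) * us 0 0"
      unfolding power2_eq_square by (metis mult.assoc mult.commute)
    then show ?thesis
      using \<open>us 0 0 \<noteq> 0\<close> by simp
  qed
  have P_error: "\<exists>C. \<forall>\<^sub>F \<epsilon> in at_right 0. \<bar>PE \<epsilon> $ i $ j - P 0 $ i $ j\<bar> \<le> C * \<epsilon>" for i j
    using power_expansion_leading_error[OF power_expansion_bounded_linear[OF entry P[folded PE_def]]]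
    by simp
  obtain C3 C4 where "\<forall>\<^sub>F \<epsilon> in at_right 0. \<bar>PE \<epsilon> $ 1 $ 2 - P 0 $ 1 $ 2\<bar> \<le> C3 * \<epsilon>"
      "\<forall>\<^sub>F \<epsilon> in at_right 0. \<bar>PE \<epsilon> $ 2 $ 1 - P 0 $ 2 $ 1\<bar> \<le> C4 * \<epsilon>"
    using P_error[of 1 2] P_error[of 2 1] by blast
  from decay_rate_perturbation[OF this \<open>l > 0\<close> P_product]
  obtain C1 where rate: "\<forall>\<^sub>F \<epsilon> in at_right 0. \<bar>sqrt (PE \<epsilon> $ 1 $ 2 * PE \<epsilon> $ 2 $ 1) / 2 - l\<bar> \<le> C1 * \<epsilon>"
    by blast
  obtain C2 where U0: "\<forall>\<^sub>F \<epsilon> in at_right 0. \<forall>\<eta>. \<bar>U \<epsilon> \<eta> - us 0 \<eta>\<bar> \<le> C2 * \<epsilon>"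
    using U[unfolded uniform_power_expansion_def, rule_format, of 1] by auto
  from alternation U0 eventually_at_right_less[of "0 :: real"]
  have "\<forall>\<^sub>F \<epsilon> in at_right 0. \<forall>n::int. \<bar>\<bar>u \<epsilon> (of_int n)\<bar> - K * exp (- l * (\<epsilon> * \<bar>real_of_int n\<bar>))\<bar> \<le> C2 * \<epsilon>"
  proof eventually_elim
    case (elim \<epsilon>)
    show ?case
    proof
      fix n :: int
      have "\<bar>u \<epsilon> (of_int n)\<bar> = \<bar>U \<epsilon> (\<epsilon> * of_int n)\<bar>"
        using elim(1) by (simp add: abs_mult power_int_abs)
      moreover have "\<bar>us 0 (\<epsilon> * of_int n)\<bar> = K * exp (- l * (\<epsilon> * \<bar>real_of_int n\<bar>))"
        using elim(3) by (simp add: us_K abs_mult)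
      ultimately show "\<bar>\<bar>u \<epsilon> (of_int n)\<bar> - K * exp (- l * (\<epsilon> * \<bar>real_of_int n\<bar>))\<bar> \<le> C2 * \<epsilon>"
        using elim(2)[rule_format, of "\<epsilon> * of_int n"] by linarith
    qed
  qed
  from normalised_profile[OF \<open>K > 0\<close> this \<open>l > 0\<close> normalised]
  have profile: "\<forall>\<^sub>F \<epsilon> in at_right 0. \<forall>n::int.
      \<bar>\<bar>\<alpha> \<epsilon> * u \<epsilon> (of_int n)\<bar> - exp (- l * (\<epsilon> * \<bar>real_of_int n\<bar>))\<bar> \<le> 4 * C2 / K * \<epsilon>" .
  have "((\<lambda>\<epsilon>. C1 * \<epsilon>) \<longlongrightarrow> C1 * 0) (at_right 0)"
    by (intro tendsto_intros)
  then have "\<forall>\<^sub>F \<epsilon> in at_right 0. C1 * \<epsilon> < l / 2"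
    by (rule order_tendstoD) (use \<open>l > 0\<close> in simp)
  with profile rate eventually_at_right_less[of "0 :: real"]
  have "\<forall>\<^sub>F \<epsilon> in at_right 0. \<forall>n::int.
           \<bar> \<bar>\<alpha> \<epsilon> * u \<epsilon> (of_int n)\<bar>
             - exp (- (1/2) * sqrt ((TB \<epsilon> (\<omega> \<epsilon>) $ 1 $ 2 - TA \<epsilon> (\<omega> \<epsilon>) $ 1 $ 2) *
                                    (TB \<epsilon> (\<omega> \<epsilon>) $ 2 $ 1 - TA \<epsilon> (\<omega> \<epsilon>) $ 2 $ 1))
                    * \<bar>real_of_int n\<bar>) \<bar> \<le> (4 * C2 / K + 2 / l * C1) * \<epsilon>"
  proof eventually_elim
    case (elim \<epsilon>)
    define m where "m = sqrt (PE \<epsilon> $ 1 $ 2 * PE \<epsilon> $ 2 $ 1) / 2"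
    have difference: "TB \<epsilon> (\<omega> \<epsilon>) $ i $ j - TA \<epsilon> (\<omega> \<epsilon>) $ i $ j = \<epsilon> * PE \<epsilon> $ i $ j" for i j
      using elim(3) by (simp add: PE_def)
    have "sqrt (\<epsilon> * PE \<epsilon> $ 1 $ 2 * (\<epsilon> * PE \<epsilon> $ 2 $ 1)) = \<epsilon> * sqrt (PE \<epsilon> $ 1 $ 2 * PE \<epsilon> $ 2 $ 1)"
    proof -
      have "sqrt (\<epsilon> * PE \<epsilon> $ 1 $ 2 * (\<epsilon> * PE \<epsilon> $ 2 $ 1)) = sqrt (\<epsilon>\<^sup>2 * (PE \<epsilon> $ 1 $ 2 * PE \<epsilon> $ 2 $ 1))"
        by (simp add: power2_eq_square mult_ac)
      then show ?thesis
        using elim(3) by (simp add: real_sqrt_mult)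
    qed
    then have exponent: "- (1/2) * sqrt (\<epsilon> * PE \<epsilon> $ 1 $ 2 * (\<epsilon> * PE \<epsilon> $ 2 $ 1)) * \<bar>real_of_int n\<bar>
        = - m * (\<epsilon> * \<bar>real_of_int n\<bar>)" for n
      by (simp add: m_def)
    have m: "\<bar>m - l\<bar> \<le> C1 * \<epsilon>" "m \<ge> l / 2"
      using elim(2,4) unfolding m_def[symmetric] by linarith+
    show ?case
      unfolding difference exponent
    proof
      fix n :: int
      have "\<bar>exp (- m * (\<epsilon> * \<bar>real_of_int n\<bar>)) - exp (- l * (\<epsilon> * \<bar>real_of_int n\<bar>))\<bar> \<le> 2 / l * \<bar>m - l\<bar>"
        by (rule exp_rate_perturbation[OF \<open>l > 0\<close> m(2)]) (use elim(3) in simp)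
      also have "\<dots> \<le> 2 / l * (C1 * \<epsilon>)"
        using m(1) \<open>l > 0\<close> by (intro mult_left_mono) auto
      finally show "\<bar>\<bar>\<alpha> \<epsilon> * u \<epsilon> (of_int n)\<bar> - exp (- m * (\<epsilon> * \<bar>real_of_int n\<bar>))\<bar> \<le> (4 * C2 / K + 2 / l * C1) * \<epsilon>"
        using elim(1)[rule_format, of n] unfolding distrib_right by linarith
    qed
  qed
  then show ?thesis ..
qed

end
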